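(* There exists an infinite sequence of trees $(T_k)_{k\in\mathbb{N}}$ such that $\lim_{k\to\infty} n(T_k)=\lim_{k\to\infty} m(T_k)=\infty$ and $f(T_k)\geq 0.3$ for all $k\in\mathbb{N}$, where $$f(T)=\left|\frac{p_A(T)}{m(T)}-\left(1-\frac{p_D(T)}{n(T)}\right)\right|.$$
   Context: Let $T$ be a tree on $N$ vertices with adjacency matrix $A(T)$ and distance matrix $D(T)$, whose $(i,j)$ entry is the graph distance between vertices $i$ and $j$. Adjacency side. Write the characteristic polynomial of $A(T)$, with zero coefficients omitted, as $CPA(T)=\sum_{i=0}^{m-1} a_i x^{\alpha_i}$, where $\alpha_0<\alpha_1<\dots<\alpha_{m-1}$ and every $a_i\neq 0$. Then $m(T)$ is the number of non-zero coefficients of $CPA(T)$. The peak position $p_A(T)$ is the position, counted from $1$ in order of increasing exponent, of the maximum of the sequence $|a_0|,|a_1|,\dots,|a_{m-1}|$. So if $|a_0|$ is the maximum, then $p_A(T)=1$. Distance side. Write $CPD(T)=\det(D(T)-xI)=\sum_{k=0}^{N}\delta_k x^k$. The normalized coefficients are $d_k=\frac{2^k}{2^{N-2}}|\delta_k|$. The peak $p_D(T)$ is the index $k$ at which the sequence $d_0(T),\dots,d_{N-2}(T)$ attains its maximum. Finally, $n(T)=N+1$ is the number of terms of $CPD(T)$. *)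

theory Defs
  imports
    Complex_Main
    "Graph_Theory.Graph_Theory"
    "Jordan_Normal_Form.Char_Poly"
begin

text \<open>
  Undirected simple graphs are represented, as in the library, by finite loop-free symmetric
  digraphs (\<^locale>\<open>pair_graph\<close>): an edge is a pair of opposite arcs. In this encoding
  going back and forth along an edge is a directed cycle of length 2, so the library predicates
  \<open>forest\<close> and \<open>tree\<close> do not describe undirected trees; the cycles of the
  undirected graph are the directed cycles of length at least 3.
  The vertices are labelled \<open>0, \<dots>, N - 1\<close> so that they index the rows and columns
  of the matrices below.
\<close>

definition labelled_tree :: "nat pair_pre_digraph \<Rightarrow> bool" where
  "labelled_tree T \<longleftrightarrow>
     pair_graph T \<and>
     pverts T = {..<card (pverts T)} \<and>
     Digraph_Component.connected (with_proj T) \<and>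
     \<not> (\<exists>p. pre_digraph.cycle (with_proj T) p \<and> 3 \<le> length p)"

definition graph_dist :: "nat pair_pre_digraph \<Rightarrow> nat \<Rightarrow> nat \<Rightarrow> nat" where
  "graph_dist T u v = (LEAST l. \<exists>p. pre_digraph.awalk (with_proj T) u p v \<and> length p = l)"

definition adjacency_matrix :: "nat pair_pre_digraph \<Rightarrow> real mat" where
  "adjacency_matrix T =
     mat (card (pverts T)) (card (pverts T)) (\<lambda>(i, j). if (i, j) \<in> parcs T then 1 else 0)"

definition distance_matrix :: "nat pair_pre_digraph \<Rightarrow> real mat" where
  "distance_matrix T =
     mat (card (pverts T)) (card (pverts T)) (\<lambda>(i, j). real (graph_dist T i j))"

definition CPA :: "nat pair_pre_digraph \<Rightarrow> real poly" where
  "CPA T = char_poly (adjacency_matrix T)"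

text \<open>The list \<open>[\<alpha>\<^sub>0, \<alpha>\<^sub>1, \<dots>]\<close> of exponents occurring in \<^term>\<open>CPA T\<close>, in increasing order.\<close>

definition CPA_exponents :: "nat pair_pre_digraph \<Rightarrow> nat list" where
  "CPA_exponents T = sorted_list_of_set {i. coeff (CPA T) i \<noteq> 0}"

definition num_terms_A :: "nat pair_pre_digraph \<Rightarrow> nat" where
  "num_terms_A T = card {i. coeff (CPA T) i \<noteq> 0}"

text \<open>
  Peaks are given by \<^const>\<open>arg_max\<close>, which returns an unspecified maximiser if the maximum is
  attained more than once. The list is indexed from 0, positions are counted from 1.
\<close>

definition peak_A :: "nat pair_pre_digraph \<Rightarrow> nat" where
  "peak_A T =
     Suc (ARG_MAX (\<lambda>i. \<bar>coeff (CPA T) (CPA_exponents T ! i)\<bar>) i. i < num_terms_A T)"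

definition CPD :: "nat pair_pre_digraph \<Rightarrow> real poly" where
  "CPD T =
     det (map_mat (\<lambda>a. [:a:]) (distance_matrix T) - [:0, 1:] \<cdot>\<^sub>m 1\<^sub>m (card (pverts T)))"

definition normalized_coeff_D :: "nat pair_pre_digraph \<Rightarrow> nat \<Rightarrow> real" where
  "normalized_coeff_D T k = 2 ^ k / 2 ^ (card (pverts T) - 2) * \<bar>coeff (CPD T) k\<bar>"

definition peak_D :: "nat pair_pre_digraph \<Rightarrow> nat" where
  "peak_D T = (ARG_MAX (normalized_coeff_D T) k. k \<le> card (pverts T) - 2)"

definition num_terms_D :: "nat pair_pre_digraph \<Rightarrow> nat" where
  "num_terms_D T = card (pverts T) + 1"

definition peak_discrepancy :: "nat pair_pre_digraph \<Rightarrow> real" where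
  "peak_discrepancy T =
     \<bar>real (peak_A T) / real (num_terms_A T) - (1 - real (peak_D T) / real (num_terms_D T))\<bar>"

end

theory Submission
  imports Defs
begin

text \<open>
  Take the tree with a root, \<open>L\<close> hubs adjacent to the root and \<open>M\<close> leaves at every hub, where
  \<open>M > L\<close>, and let \<open>N = L (M + 1) + 1\<close> be its number of vertices. On the adjacency side
  \<open>CPA = x\<^bsup>L(M-1)+1\<^esup> (x\<^sup>2 - M)\<^bsup>L-1\<^esup> (x\<^sup>2 - M - L)\<close>; its \<open>L + 1\<close> non-zero coefficients decrease in
  absolute value because \<open>M > L\<close>, so the peak position is 1. On the distance side the many twin
  leaves give the eigenvalue -2 with multiplicity \<open>K = L (M - 1)\<close>; after the substitution
  \<open>x = 2 y\<close>, which turns coefficients into normalized ones, \<open>CPD\<close> is a multiple of \<open>(1 + y)\<^sup>K Q(y)\<close>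
  with \<open>Q\<close> of degree \<open>2 L + 1\<close>. As \<open>Q\<close> has nonnegative coefficients except for the leading one,
  which is dominated by its neighbour, the coefficients of the product decrease strictly
  from index \<open>K / 2 + 2 L + 1\<close> up to \<open>N - 2\<close>. Hence \<open>p\<^sub>A / m\<close> is close to 0 and \<open>p\<^sub>D / n\<close> is at most about \<open>1 / 2\<close>.
\<close>

subsection \<open>Trees given by a parent function\<close>

definition parent_tree :: "nat \<Rightarrow> (nat \<Rightarrow> nat) \<Rightarrow> nat pair_pre_digraph" where
  "parent_tree N p = \<lparr>pverts = {..<N},
     parcs = {(u, v). u < N \<and> v < N \<and> (0 < v \<and> u = p v \<or> 0 < u \<and> v = p u)}\<rparr>"

lemma parent_tree_simps [simp]:
  "pverts (parent_tree N p) = {..<N}"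
  "(u, v) \<in> parcs (parent_tree N p) \<longleftrightarrow>
     u < N \<and> v < N \<and> (0 < v \<and> u = p v \<or> 0 < u \<and> v = p u)"
  by (auto simp: parent_tree_def)

text \<open>Smaller labels for parents build acyclicity into the numbering: every descent along
  parents ends at the root 0, and elimination from large to small labels is triangular.\<close>

locale parent_function =
  fixes N :: nat and p :: "nat \<Rightarrow> nat"
  assumes N_pos: "0 < N"
    and parent_less: "\<And>v. 0 < v \<Longrightarrow> v < N \<Longrightarrow> p v < v"
begin

lemma pair_graph_parent_tree: "pair_graph (parent_tree N p)"
proof
  have "parcs (parent_tree N p) \<subseteq> {..<N} \<times> {..<N}" by auto
  then show "finite (parcs (parent_tree N p))" by (rule finite_subset) simp
  show "symmetric (with_proj (parent_tree N p))"
    by (auto simp: symmetric_def sym_def)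
  show "fst e \<noteq> snd e" if "e \<in> parcs (parent_tree N p)" for e
    using that parent_less[of "fst e"] parent_less[of "snd e"] by (cases e) auto
qed auto

sublocale pair_graph "parent_tree N p"
  by (rule pair_graph_parent_tree)

lemma reachable_root:
  assumes "v < N"
  shows "v \<rightarrow>\<^sup>*\<^bsub>with_proj (parent_tree N p)\<^esub> 0"
  using assms
proof (induction v rule: less_induct)
  case (less v)
  show ?case
  proof (cases "v = 0")
    case True
    then show ?thesis using N_pos by (simp add: reachable_refl)
  next
    case False
    have pv: "p v < v" "p v < N" using parent_less[of v] False less.prems by auto
    have "(v, p v) \<in> parcs (parent_tree N p)" using False less.prems pv by simp
    then show ?thesis using less.IH[OF pv] by (rule adj_reachable_trans)
  qed
qed

lemma connected_parent_tree: "Digraph_Component.connected (with_proj (parent_tree N p))"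
proof -
  have "u \<rightarrow>\<^sup>*\<^bsub>with_proj (parent_tree N p)\<^esub> v" if "u < N" "v < N" for u v
    using reachable_root[OF that(1)] reachable_root[OF that(2)] symmetric_reachable[OF sym_arcs]
    by (meson reachable_trans)
  then show ?thesis
    using N_pos reachable_mk_symmetricI by (auto simp: connected_def intro!: strongly_connectedI)
qed

text \<open>The two neighbours on a cycle of its largest vertex would both be the parent of that vertex.\<close>

lemma no_long_cycle:
  assumes "cycle c" "3 \<le> length c"
  shows False
proof -
  from assms obtain u where u: "awalk u c u" "distinct (tl (awalk_verts u c))"
    unfolding cycle_def by auto
  define n where "n = length c"
  define w where "w i = (if i = 0 then snd (c ! (n - 1)) else snd (c ! (i - 1)))" for i
  have cne: "c \<noteq> []" using assms by auto
  \<comment> \<open>The vertices of the walk are \<open>u\<close> followed by the heads of its arcs,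
    so distinctness of the tail means that the heads are distinct.\<close>
  have vs: "awalk_verts u c = u # map snd c"
    using awalk_verts_conv'[of u c u] u cne by (auto simp: awalk_def hd_map cas_simp)
  then have dist: "distinct (map snd c)" using u by simp
  have chain: "fst (c ! Suc i) = snd (c ! i)" if "Suc i < n" for i
  proof -
    have "awalk_verts u c = map fst c @ [snd (last c)]" using awalk_verts_conv[of u c] cne by simp
    then have "(u # map snd c) ! Suc i = (map fst c @ [snd (last c)]) ! Suc i" using vs by simp
    then show ?thesis using that by (simp add: nth_append n_def)
  qed
  have first: "fst (c ! 0) = snd (c ! (n - 1))"
  proof -
    have "last (awalk_verts u c) = u" using u by auto
    then have "snd (last c) = u" using vs cne by (simp add: last_map)
    moreover have "fst (hd c) = u" using u cne by (auto simp: awalk_def cas_simp)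
    ultimately show ?thesis using cne by (simp add: hd_conv_nth last_conv_nth n_def)
  qed
  define x where "x = Max (set (map snd c))"
  have "x \<in> set (map snd c)" unfolding x_def using cne by (intro Max_in) auto
  then obtain i where i: "i < n" "x = snd (c ! i)" by (auto simp: in_set_conv_nth n_def)
  have le: "snd (c ! j) \<le> x" if "j < n" for j
    unfolding x_def using that by (intro Max_ge) (auto simp: n_def)
  \<comment> \<open>\<open>j\<close> and \<open>k\<close> are the cyclic predecessor and successor
    of \<open>i\<close>. They differ because the length is at least 3; in a 2-cycle they would
    coincide.\<close>
  define j where "j = (if i = 0 then n - 1 else i - 1)"
  define k where "k = (if Suc i = n then 0 else Suc i)"
  have jk: "j < n" "k < n" "j \<noteq> k" using i assms(2) by (auto simp: j_def k_def n_def)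
  have fi: "fst (c ! i) = snd (c ! j)"
    using first chain[of "i - 1"] i by (auto simp: j_def)
  have fk: "fst (c ! k) = x"
    using first chain[of i] i by (auto simp: k_def)
  have arc: "c ! l \<in> parcs (parent_tree N p)" if "l < n" for l
    using u(1) that by (auto simp: awalk_def n_def)
  \<comment> \<open>If \<open>x\<close> were the parent of this neighbour, the neighbour would
    exceed the maximum \<open>x\<close>; so the neighbour is the parent of \<open>x\<close>.\<close>
  have 1: "snd (c ! j) = p x"
  proof -
    have "(snd (c ! j), x) \<in> parcs (parent_tree N p)"
      using arc[OF i(1)] fi i(2) by (metis prod.collapse)
    then show ?thesis using le[OF jk(1)] parent_less[of "snd (c ! j)"] by auto
  qed
  have 2: "snd (c ! k) = p x"
  proof -
    have "(x, snd (c ! k)) \<in> parcs (parent_tree N p)"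
      using arc[OF jk(2)] fk by (metis prod.collapse)
    then show ?thesis using le[OF jk(2)] parent_less[of "snd (c ! k)"] by auto
  qed
  have "map snd c ! j = map snd c ! k" using 1 2 jk by (simp add: n_def)
  then show False using dist jk nth_eq_iff_index_eq[of "map snd c" j k] by (simp add: n_def)
qed

lemma labelled_tree_parent_tree: "labelled_tree (parent_tree N p)"
  using pair_graph_parent_tree connected_parent_tree no_long_cycle
  by (auto simp: labelled_tree_def)

end

text \<open>A certificate for distances to a fixed target: \<open>lip\<close> bounds the length of
  every walk from below, and \<open>step\<close> yields a walk of length \<open>d u v\<close> by
  descending one unit at a time.\<close>

lemma graph_dist_eqI:
  fixes T :: "nat pair_pre_digraph" and d :: "nat \<Rightarrow> nat \<Rightarrow> nat"
  assumes wf: "pair_wf_digraph T"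
    and refl: "\<And>v. v \<in> pverts T \<Longrightarrow> d v v = 0"
    and lip: "\<And>u u' v. (u, u') \<in> parcs T \<Longrightarrow> v \<in> pverts T \<Longrightarrow> d u v \<le> Suc (d u' v)"
    and step: "\<And>u v. u \<in> pverts T \<Longrightarrow> v \<in> pverts T \<Longrightarrow> u \<noteq> v \<Longrightarrow>
      \<exists>u'. (u, u') \<in> parcs T \<and> d u v = Suc (d u' v)"
    and uv: "u \<in> pverts T" "v \<in> pverts T"
  shows "graph_dist T u v = d u v"
proof -
  interpret pair_wf_digraph T by (rule wf)
  have lower: "d u v \<le> length q" if "awalk u q v" for q
    using that
  proof (induction q arbitrary: u)
    case Nil
    then show ?case using uv refl by (auto simp: awalk_Nil_iff)
  next
    case (Cons e q)
    then have "e \<in> parcs T" "u = fst e" "d (snd e) v \<le> length q"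
      by (auto simp: awalk_Cons_iff)
    with lip[of u "snd e" v] uv show ?case by auto
  qed
  have upper: "\<exists>q. awalk u q v \<and> length q = n" if "d u v = n" "u \<in> pverts T" for n u
    using that
  proof (induction n arbitrary: u)
    case 0
    then have "u = v" using step[of u v] uv by fastforce
    then show ?case using uv by (auto simp: awalk_Nil_iff)
  next
    case (Suc n)
    then have "u \<noteq> v" using refl uv by force
    with step[of u v] Suc uv obtain u' where u': "(u, u') \<in> parcs T" "d u' v = n" by auto
    then obtain q where "awalk u' q v" "length q = n"
      using Suc.IH[of u'] by (auto dest: in_arcsD2)
    then have "awalk u ((u, u') # q) v" "length ((u, u') # q) = Suc n"
      using u' by (auto simp: awalk_Cons_iff)
    then show ?case by blast
  qed
  show ?thesis unfolding graph_dist_def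
    using upper[OF refl[THEN HOL.trans]] upper[of u "d u v"] lower uv
    by (intro Least_equality) auto
qed

subsection \<open>Determinants\<close>

text \<open>Sylvester's identity. The block matrix \<open>?X\<close> factors both as
  \<open>?L * ?U1\<close> and as \<open>?U2 * ?L\<close>, where all three factors are block
  triangular and \<open>?L\<close> has determinant 1.\<close>

lemma det_one_plus_mult_commute:
  fixes Z V :: "'a :: idom mat"
  assumes Z: "Z \<in> carrier_mat n m" and V: "V \<in> carrier_mat m n"
  shows "det (1\<^sub>m n + Z * V) = det (1\<^sub>m m + V * Z)"
proof -
  have mZ: "- Z \<in> carrier_mat n m" using Z by auto
  have ZV: "Z * V \<in> carrier_mat n n" and VZ: "V * Z \<in> carrier_mat m m"
    using Z V by auto
  let ?L = "four_block_mat (1\<^sub>m n) (0\<^sub>m n m) V (1\<^sub>m m)"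
  let ?X = "four_block_mat (1\<^sub>m n) (- Z) V (1\<^sub>m m)"
  let ?U1 = "four_block_mat (1\<^sub>m n) (- Z) (0\<^sub>m m n) (1\<^sub>m m + V * Z)"
  let ?U2 = "four_block_mat (1\<^sub>m n + Z * V) (- Z) (0\<^sub>m m n) (1\<^sub>m m)"
  have VmZ: "V * - Z = - (V * Z)" "- Z * V = - (Z * V)"
    using Z V by auto
  have "V * - Z + 1\<^sub>m m * (1\<^sub>m m + V * Z) = 1\<^sub>m m"
    using Z V VZ by (intro eq_matI) (auto simp: VmZ left_mult_one_mat[of _ m m])
  then have X1: "?L * ?U1 = ?X"
    using Z V mZ VZ
    by (subst mult_four_block_mat[of _ n n _ m _ m _ _ n _ m]) (auto intro!: cong_four_block_mat)
  have "(1\<^sub>m n + Z * V) * 1\<^sub>m n + - Z * V = 1\<^sub>m n"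
    using Z V ZV by (intro eq_matI) (auto simp: VmZ right_mult_one_mat[of _ n n])
  then have X2: "?U2 * ?L = ?X"
    using Z V mZ ZV
    by (subst mult_four_block_mat[of _ n n _ m _ m _ _ n _ m]) (auto intro!: cong_four_block_mat)
  have L: "det ?L = 1"
    using V by (subst det_four_block_mat_upper_right_zero[of _ n _ m]) auto
  have U1: "det ?U1 = det (1\<^sub>m m + V * Z)"
    using mZ VZ by (subst det_four_block_mat_lower_left_zero[of _ n _ m]) auto
  have U2: "det ?U2 = det (1\<^sub>m n + Z * V)"
    using mZ ZV by (subst det_four_block_mat_lower_left_zero[of _ n _ m]) auto
  have "det (?L * ?U1) = det ?L * det ?U1" using V VZ by (intro det_mult[of _ "n + m"]) auto
  moreover have "det (?U2 * ?L) = det ?U2 * det ?L" using V ZV by (intro det_mult[of _ "n + m"]) auto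
  ultimately show ?thesis using X1 X2 L U1 U2 by simp
qed

lemma det_identity_plus_rank_one:
  fixes z v :: "nat \<Rightarrow> 'a :: idom"
  shows "det (mat n n (\<lambda>(i, j). (if i = j then 1 else 0) + z i * v j)) = 1 + (\<Sum>k<n. v k * z k)"
proof -
  define Z where "Z = mat n 1 (\<lambda>(i, j). z i)"
  define V where "V = mat 1 n (\<lambda>(i, j). v j)"
  have eq: "det (1\<^sub>m n + Z * V) = det (1\<^sub>m 1 + V * Z)"
    by (rule det_one_plus_mult_commute) (auto simp: Z_def V_def)
  have "1\<^sub>m n + Z * V = mat n n (\<lambda>(i, j). (if i = j then 1 else 0) + z i * v j)"
    by (auto simp: Z_def V_def scalar_prod_def intro!: eq_matI)
  moreover have "det (1\<^sub>m 1 + V * Z) = 1 + (\<Sum>k<n. v k * z k)"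
    by (subst det_single)
       (auto simp: Z_def V_def scalar_prod_def atLeast0LessThan intro!: sum.cong)
  ultimately show ?thesis using eq by simp
qed

text \<open>A solution z of a z = u stands in for the inverse of a: the updated matrix factors as a
  (I + z v^T).\<close>

lemma det_rank_one_update:
  fixes a :: "nat \<Rightarrow> nat \<Rightarrow> 'a :: idom"
  assumes "\<And>i. i < n \<Longrightarrow> (\<Sum>k<n. a i k * z k) = u i"
  shows "det (mat n n (\<lambda>(i, j). a i j + u i * v j)) =
    det (mat n n (\<lambda>(i, j). a i j)) * (1 + (\<Sum>k<n. v k * z k))"
proof -
  let ?A = "mat n n (\<lambda>(i, j). a i j)"
  let ?R = "mat n n (\<lambda>(i, j). (if i = j then 1 else 0) + z i * v j)"
  have "mat n n (\<lambda>(i, j). a i j + u i * v j) = ?A * ?R"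
  proof (rule eq_matI)
    fix i j assume ij: "i < dim_row (?A * ?R)" "j < dim_col (?A * ?R)"
    then have "(?A * ?R) $$ (i, j) = (\<Sum>k<n. a i k * ((if k = j then 1 else 0) + z k * v j))"
      by (simp add: scalar_prod_def atLeast0LessThan)
    also have "\<dots> = (\<Sum>k<n. (if k = j then a i k else 0) + a i k * z k * v j)"
      by (intro sum.cong) (auto simp: algebra_simps)
    also have "\<dots> = a i j + u i * v j"
      using ij by (simp add: sum.distrib assms flip: sum_distrib_right)
    finally show "mat n n (\<lambda>(i, j). a i j + u i * v j) $$ (i, j) = (?A * ?R) $$ (i, j)"
      using ij by simp
  qed auto
  then show ?thesis
    by (simp add: det_mult[of _ n] det_identity_plus_rank_one)
qed

text \<open>Two rank one updates in succession, first by -1 h^T and then by -h 1^T. Distance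
  matrices of the trees have this shape, with \<open>h\<close> the depth and \<open>c\<close>
  correcting pairs in a common branch.\<close>

lemma det_rank_two_update:
  fixes c :: "nat \<Rightarrow> nat \<Rightarrow> 'a :: field"
  assumes w: "\<And>i. i < n \<Longrightarrow> (\<Sum>k<n. c i k * w k) = 1"
    and y: "\<And>i. i < n \<Longrightarrow> (\<Sum>k<n. c i k * y k) = h i"
    and ne: "(\<Sum>k<n. h k * w k) \<noteq> 1"
  shows "det (mat n n (\<lambda>(i, j). c i j - h i - h j)) = det (mat n n (\<lambda>(i, j). c i j)) *
    ((1 - (\<Sum>k<n. h k * w k)) * (1 - (\<Sum>k<n. y k)) - (\<Sum>k<n. h k * y k) * (\<Sum>k<n. w k))"
proof -
  define \<beta> where "\<beta> = (\<Sum>k<n. h k * w k)"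
  define \<alpha> where "\<alpha> = (\<Sum>k<n. h k * y k)"
  \<comment> \<open>Chosen so that \<open>y + s * w\<close> solves the system with right-hand side
    \<open>h\<close> after the first update: the constant -\<alpha> left over by \<open>y\<close> is
    cancelled by s (1 - \<beta>).\<close>
  define s where "s = \<alpha> / (1 - \<beta>)"
  have ne': "1 - \<beta> \<noteq> 0" using ne by (simp add: \<beta>_def)
  have "det (mat n n (\<lambda>(i, j). c i j + (- 1) * h j)) =
      det (mat n n (\<lambda>(i, j). c i j)) * (1 + (\<Sum>k<n. h k * - w k))"
    by (rule det_rank_one_update[where u = "\<lambda>_. - 1"]) (simp add: sum_negf w)
  then have 1: "det (mat n n (\<lambda>(i, j). c i j - h j)) = det (mat n n (\<lambda>(i, j). c i j)) * (1 - \<beta>)"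
    by (simp add: sum_negf \<beta>_def)
  have "(\<Sum>k<n. (c i k - h k) * - (y k + s * w k)) = - h i" if "i < n" for i
  proof -
    have "(\<Sum>k<n. (c i k - h k) * - (y k + s * w k)) =
        (\<Sum>k<n. - (c i k * y k) - s * (c i k * w k) + h k * y k + s * (h k * w k))"
      by (intro sum.cong) (auto simp: algebra_simps)
    also have "\<dots> = - h i - s + \<alpha> + s * \<beta>"
      by (simp add: sum.distrib sum_subtractf sum_negf w y that \<alpha>_def \<beta>_def flip: sum_distrib_left)
    also have "s * \<beta> = s - \<alpha>" using ne' by (simp add: s_def field_simps)
    also have "- h i - s + \<alpha> + (s - \<alpha>) = - h i" by simp
    finally show ?thesis .
  qed
  then have "det (mat n n (\<lambda>(i, j). (c i j - h j) + (- h i) * 1)) =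
      det (mat n n (\<lambda>(i, j). c i j - h j)) * (1 + (\<Sum>k<n. 1 * - (y k + s * w k)))"
    by (intro det_rank_one_update) auto
  also have "(\<Sum>k<n. 1 * - (y k + s * w k)) = - (\<Sum>k<n. y k) - s * (\<Sum>k<n. w k)"
    by (simp add: sum_subtractf sum_negf sum_distrib_left)
  finally have "det (mat n n (\<lambda>(i, j). c i j - h i - h j)) = det (mat n n (\<lambda>(i, j). c i j)) *
      ((1 - \<beta>) * (1 - (\<Sum>k<n. y k) - s * (\<Sum>k<n. w k)))"
    by (simp add: 1 algebra_simps)
  also have "(1 - \<beta>) * (1 - (\<Sum>k<n. y k) - s * (\<Sum>k<n. w k)) =
      (1 - \<beta>) * (1 - (\<Sum>k<n. y k)) - (1 - \<beta>) * s * (\<Sum>k<n. w k)"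
    by (simp only: right_diff_distrib mult.assoc)
  also have "(1 - \<beta>) * s = \<alpha>" using ne' by (simp add: s_def)
  finally show ?thesis by (simp add: \<alpha>_def \<beta>_def)
qed

text \<open>Each class adds a rank one block t J. On class \<open>m\<close> the blocks added before
  vanish, so the required solution vector is just t / \<delta> supported on that class.\<close>

lemma det_diagonal_plus_blocks:
  fixes \<delta> :: "nat \<Rightarrow> real" and c :: "nat \<Rightarrow> nat"
  assumes nz: "\<And>i. i < n \<Longrightarrow> \<delta> i \<noteq> 0"
  shows "det (mat n n (\<lambda>(i, j). (if i = j then \<delta> i else 0) + (if c i = c j \<and> c i < m then t else 0))) =
    (\<Prod>i<n. \<delta> i) * (\<Prod>a<m. 1 + t * (\<Sum>k<n. if c k = a then 1 / \<delta> k else 0))"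
proof (induction m)
  case 0
  let ?A = "mat n n (\<lambda>(i, j). if i = j then \<delta> i else 0)"
  have "det ?A = prod_list (diag_mat ?A)"
    by (rule det_upper_triangular[of _ n]) auto
  then show ?case by (simp add: prod_list_diag_prod atLeast0LessThan)
next
  case (Suc m)
  let ?a = "\<lambda>i j. (if i = j then \<delta> i else 0) + (if c i = c j \<and> c i < m then t else 0)"
  have "(\<Sum>k<n. ?a i k * (if c k = m then t / \<delta> k else 0)) = (if c i = m then t else 0)"
    if "i < n" for i
  proof -
    have "(\<Sum>k<n. ?a i k * (if c k = m then t / \<delta> k else 0)) =
      (\<Sum>k<n. if k = i then (if c i = m then t else 0) else 0)"
      using nz by (intro sum.cong) auto
    then show ?thesis using that by simp
  qed
  then have "det (mat n n (\<lambda>(i, j). ?a i j + (if c i = m then t else 0) * (if c j = m then 1 else 0))) =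
      det (mat n n (\<lambda>(i, j). ?a i j)) *
        (1 + (\<Sum>k<n. (if c k = m then 1 else 0) * (if c k = m then t / \<delta> k else 0)))"
    by (rule det_rank_one_update)
  also have "mat n n (\<lambda>(i, j). ?a i j + (if c i = m then t else 0) * (if c j = m then 1 else 0)) =
     mat n n (\<lambda>(i, j). (if i = j then \<delta> i else 0) + (if c i = c j \<and> c i < Suc m then t else 0))"
    by (intro eq_matI) auto
  also have "(\<Sum>k<n. (if c k = m then 1 else 0) * (if c k = m then t / \<delta> k else 0)) =
      t * (\<Sum>k<n. if c k = m then 1 / \<delta> k else 0)"
    by (subst sum_distrib_left, intro sum.cong) auto
  finally show ?case unfolding Suc.IH by simp
qed

text \<open>
  Eliminating the vertices from the leaves to the root causes no fill-in: with \<open>e i k = 1\<close> when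
  \<open>i\<close> is the parent of \<open>k\<close>, the product of the upper triangular matrix with entries
  \<open>[i = k] d i - e i k\<close> and the lower triangular matrix with entries \<open>[k = j] - e j k / d k\<close>
  is the matrix below.
\<close>

lemma det_tree_elimination:
  fixes d :: "nat \<Rightarrow> real" and p :: "nat \<Rightarrow> nat"
  assumes less: "\<And>v. 0 < v \<Longrightarrow> v < n \<Longrightarrow> p v < v"
    and nz: "\<And>v. v < n \<Longrightarrow> d v \<noteq> 0"
    and d: "\<And>v. v < n \<Longrightarrow> d v + (\<Sum>k<n. if 0 < k \<and> p k = v then 1 / d k else 0) = x"
  shows "det (mat n n (\<lambda>(i, j). (if i = j then x else 0) -
    (if 0 < j \<and> i = p j \<or> 0 < i \<and> j = p i then 1 else 0))) = (\<Prod>v<n. d v)"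
proof -
  define e :: "nat \<Rightarrow> nat \<Rightarrow> real" where "e i k = (if 0 < k \<and> p k = i then 1 else 0)" for i k
  define U where "U = mat n n (\<lambda>(i, k). (if i = k then d i else 0) - e i k)"
  define L where "L = mat n n (\<lambda>(k, j). (if k = j then 1 else 0) - e j k / d k)"
  have [simp]: "U \<in> carrier_mat n n" "L \<in> carrier_mat n n" by (auto simp: U_def L_def)
  \<comment> \<open>Parents have smaller labels, so \<open>e\<close> is strictly upper triangular;
    this makes \<open>U\<close> upper triangular and \<open>L\<close> lower triangular with unit
    diagonal.\<close>
  have e0: "e i j = 0" if "j < n" "j \<le> i" for i j
    using less[of j] that by (auto simp: e_def)
  have "det U = prod_list (diag_mat U)"
    by (rule det_upper_triangular[of _ n]) (auto simp: U_def e0)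
  then have detU: "det U = (\<Prod>v<n. d v)"
    by (simp add: prod_list_diag_prod atLeast0LessThan U_def e0)
  have "det L = prod_list (diag_mat L)"
    by (rule det_lower_triangular[of n]) (auto simp: L_def e0)
  then have detL: "det L = 1"
    by (simp add: prod_list_diag_prod L_def e0)
  have "mat n n (\<lambda>(i, j). (if i = j then x else 0) -
    (if 0 < j \<and> i = p j \<or> 0 < i \<and> j = p i then 1 else 0)) = U * L" (is "?M = _")
  proof (rule eq_matI)
    fix i j assume "i < dim_row (U * L)" "j < dim_col (U * L)"
    then have ij: "i < n" "j < n" by (auto simp: U_def L_def)
    have "(U * L) $$ (i, j) =
      (\<Sum>k<n. ((if i = k then d i else 0) - e i k) * ((if k = j then 1 else 0) - e j k / d k))"
      using ij by (simp add: U_def L_def scalar_prod_def atLeast0LessThan)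
    \<comment> \<open>The product \<open>e i k * e j k\<close> vanishes for distinct i and j because
      \<open>k\<close> has only one parent. This is the absence of fill-in.\<close>
    also have "\<dots> = (\<Sum>k<n. (if k = i then (if i = j then d i else 0) - e j i else 0)
       - (if k = j then e i j else 0) + (if i = j then e i k / d k else 0))"
      using nz ij less[of i] by (intro sum.cong refl) (auto simp: e_def)
    also have "\<dots> = (if i = j then d i + (\<Sum>k<n. e i k / d k) else 0) - e j i - e i j"
      using ij by (simp add: sum.distrib sum_subtractf)
    also have "(\<Sum>k<n. e i k / d k) = (\<Sum>k<n. if 0 < k \<and> p k = i then 1 / d k else 0)"
      by (intro sum.cong) (auto simp: e_def)
    also have "(if i = j then d i + \<dots> else 0) - e j i - e i j = ?M $$ (i, j)"
      using ij d[of i] less[of i] less[of j] by (auto simp: e_def)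
    finally show "?M $$ (i, j) = (U * L) $$ (i, j)" ..
  qed (auto simp: U_def L_def)
  then show ?thesis using detU detL by (simp add: det_mult[of _ n])
qed

subsection \<open>Coefficients of polynomials\<close>

text \<open>The difference would have infinitely many roots. Characteristic polynomials can thus be
  computed at large x only, where all pivots and denominators are non-zero.\<close>

lemma poly_eqI_above:
  fixes q r :: "real poly"
  assumes "\<And>x. x > c \<Longrightarrow> poly q x = poly r x"
  shows "q = r"
proof (rule ccontr)
  assume "q \<noteq> r"
  then have "finite {x. poly (q - r) x = 0}" by (intro poly_roots_finite) simp
  moreover have "{c<..} \<subseteq> {x. poly (q - r) x = 0}" using assms by auto
  ultimately show False using infinite_Ioi finite_subset by blast
qed

lemma arg_max_on_finite:
  fixes f :: "'a \<Rightarrow> 'b :: linorder"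
  assumes "finite {x. P x}" "P a"
  shows "P (arg_max f P)" "\<And>x. P x \<Longrightarrow> f x \<le> f (arg_max f P)"
proof -
  have fin: "finite (f ` {x. P x})" "f ` {x. P x} \<noteq> {}" using assms by auto
  then obtain b where b: "P b" "f b = Max (f ` {x. P x})"
    using Max_in[OF fin] by fastforce
  have "is_arg_max f P b"
    using b fin(1) by (auto simp: is_arg_max_linorder)
  then have "is_arg_max f P (arg_max f P)" unfolding arg_max_def by (rule someI)
  then show "P (arg_max f P)" "\<And>x. P x \<Longrightarrow> f x \<le> f (arg_max f P)"
    by (auto simp: is_arg_max_linorder)
qed

lemma coeff_pcompose_monom_square:
  fixes q :: "'a :: comm_ring_1 poly"
  shows "coeff (pcompose q (monom c 2)) n = (if even n then c ^ (n div 2) * coeff q (n div 2) else 0)"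
proof (induction q arbitrary: n)
  case (pCons a q)
  show ?case
  proof (cases "n < 2")
    case True
    then show ?thesis by (cases n) (auto simp: pcompose_pCons coeff_monom_mult)
  next
    case False
    then obtain k where "n = Suc (Suc k)" by (metis add_2_eq_Suc not_less le_Suc_ex)
    then show ?thesis by (simp add: pcompose_pCons coeff_monom_mult pCons.IH algebra_simps)
  qed
qed simp

section \<open>Decreasing coefficients in products of linear factors\<close>

text \<open>Invariant of a product of n factors x + \<rho> with \<rho> \<ge> \<mu>: ratios of
  consecutive coefficients are at most n / \<mu>, multiplied out so that the condition makes sense
  beyond the degree.\<close>

definition coeffs_decay :: "real \<Rightarrow> nat \<Rightarrow> real poly \<Rightarrow> bool" where
  "coeffs_decay \<mu> n q \<longleftrightarrow> (\<forall>i\<le>n. 0 < coeff q i) \<and> (\<forall>i>n. coeff q i = 0) \<and>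
     (\<forall>i. \<mu> * coeff q (Suc i) \<le> real n * coeff q i)"

text \<open>The new coefficient at \<open>Suc i\<close> is \<rho> q_{i+1} + q_i. The first summand
  inherits the bound from \<open>q\<close>; the second is absorbed by \<mu> \<le> \<rho> and raises
  n by one.\<close>

lemma coeffs_decay_mult:
  assumes q: "coeffs_decay \<mu> n q" and \<rho>: "0 < \<mu>" "\<mu> \<le> \<rho>"
  shows "coeffs_decay \<mu> (Suc n) (q * [:\<rho>, 1:])"
proof -
  have c0: "coeff (q * [:\<rho>, 1:]) 0 = \<rho> * coeff q 0" by simp
  have cS: "coeff (q * [:\<rho>, 1:]) (Suc i) = \<rho> * coeff q (Suc i) + coeff q i" for i by simp
  have nonneg: "0 \<le> coeff q i" for i
    using q by (cases "i \<le> n") (auto simp: coeffs_decay_def less_imp_le)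
  have "0 < coeff (q * [:\<rho>, 1:]) i" if "i \<le> Suc n" for i
    using that q \<rho> nonneg[of i]
    by (cases i) (auto simp: cS c0 coeffs_decay_def intro!: add_nonneg_pos)
  moreover have "coeff (q * [:\<rho>, 1:]) i = 0" if "i > Suc n" for i
    using that q by (cases i) (auto simp: cS coeffs_decay_def)
  moreover have "\<mu> * coeff (q * [:\<rho>, 1:]) (Suc i) \<le> real (Suc n) * coeff (q * [:\<rho>, 1:]) i" for i
  proof -
    have "\<mu> * coeff (q * [:\<rho>, 1:]) (Suc i) = \<rho> * (\<mu> * coeff q (Suc i)) + \<mu> * coeff q i"
      by (simp add: algebra_simps)
    also have "\<dots> \<le> \<rho> * (real n * coeff q i) + \<rho> * coeff q i"
      using q \<rho> nonneg[of i] by (intro add_mono mult_left_mono mult_right_mono) (auto simp: coeffs_decay_def)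
    also have "\<dots> = real (Suc n) * (\<rho> * coeff q i)" by (simp add: algebra_simps)
    also have "\<dots> \<le> real (Suc n) * coeff (q * [:\<rho>, 1:]) i"
      using nonneg by (cases i) (auto intro!: mult_left_mono)
    finally show ?thesis .
  qed
  ultimately show ?thesis by (auto simp: coeffs_decay_def)
qed

lemma coeffs_decay_power:
  assumes "0 < \<mu>"
  shows "coeffs_decay \<mu> n ([:\<mu>, 1:] ^ n)"
proof (induction n)
  case 0
  then show ?case by (auto simp: coeffs_decay_def coeff_1)
next
  case (Suc n)
  then show ?case using coeffs_decay_mult[OF Suc assms order_refl] by (simp add: mult.commute)
qed

lemma coeffs_decay_less:
  assumes "coeffs_decay \<mu> n q" "real n < \<mu>" "0 < i"
  shows "coeff q i < coeff q 0"
  using \<open>0 < i\<close>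
proof (induction i rule: nat_induct_non_zero)
  have pos: "0 < coeff q i" if "i \<le> n" for i using assms that by (auto simp: coeffs_decay_def)
  have step: "coeff q (Suc i) < coeff q i" if "i \<le> n" for i
  proof -
    have "\<mu> * coeff q (Suc i) \<le> real n * coeff q i" using assms by (auto simp: coeffs_decay_def)
    also have "\<dots> < \<mu> * coeff q i" using pos[OF that] assms(2) by simp
    finally show ?thesis using assms(2) by (simp add: mult_less_cancel_left)
  qed
  {
    case 1
    show ?case using step[of 0] by simp
  next
    case (Suc i)
    show ?case
    proof (cases "i \<le> n")
      case True
      then show ?thesis using step[OF True] Suc by simp
    next
      case False
      then show ?thesis using assms pos[of 0] by (auto simp: coeffs_decay_def)
    qed
  }
qed

section \<open>Tail coefficients of products with powers of 1 + x\<close>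

text \<open>Induction on r. Each factor 1 + g x + x^2 lowers the coefficient next to the leading -1
  by g, and \<open>real r * g + 1 \<le> a\<close> keeps it at least 1. The coefficient below it then
  stays nonnegative because g \<ge> 1.\<close>

lemma cubic_times_quadratic_power_coeffs:
  fixes a b c g :: real
  assumes "0 \<le> b" "0 \<le> c" "1 \<le> g" "real r * g + 1 \<le> a"
  defines "q \<equiv> [:c, b, a, - 1:] * [:1, g, 1:] ^ r"
  shows "coeff q (2 * r + 3) = - 1" "coeff q (2 * r + 2) = a - real r * g"
    "\<And>j. j < 2 * r + 3 \<Longrightarrow> 0 \<le> coeff q j" "\<And>j. 2 * r + 3 < j \<Longrightarrow> coeff q j = 0"
proof -
  define Q where "Q r = [:c, b, a, - 1:] * [:1, g, 1:] ^ r" for r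
  have "coeff (Q r) (2 * r + 3) = - 1 \<and> coeff (Q r) (2 * r + 2) = a - real r * g \<and>
    (\<forall>j < 2 * r + 3. 0 \<le> coeff (Q r) j) \<and> (\<forall>j > 2 * r + 3. coeff (Q r) j = 0)"
    using assms(4)
  proof (induction r)
    case 0
    then show ?case using assms(1,2)
      by (auto simp: Q_def coeff_pCons numeral_eq_Suc less_Suc_eq split: nat.splits)
  next
    case (Suc r)
    have "real r * g + 1 \<le> a" using Suc.prems assms(3) by (simp add: algebra_simps)
    note IH = Suc.IH[OF this]
    have QS: "Q (Suc r) = Q r * [:1, g, 1:]" by (simp only: Q_def power_Suc2 mult.assoc)
    have coeff: "coeff (Q (Suc r)) (Suc (Suc j)) =
      coeff (Q r) (Suc (Suc j)) + g * coeff (Q r) (Suc j) + coeff (Q r) j" for j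
      by (simp add: QS)
    have coeff1: "coeff (Q (Suc r)) (Suc 0) = coeff (Q r) (Suc 0) + g * coeff (Q r) 0"
      and coeff0: "coeff (Q (Suc r)) 0 = coeff (Q r) 0"
      by (simp_all add: QS)
    have top: "coeff (Q r) (Suc (Suc (Suc (2 * r)))) = - 1" "coeff (Q r) (Suc (Suc (2 * r))) = a - real r * g"
      using IH by (simp_all add: numeral_eq_Suc)
    have low: "0 \<le> coeff (Q r) j" if "j < 2 * r + 3" for j using IH that by simp
    have high: "coeff (Q r) j = 0" if "2 * r + 3 < j" for j using IH that by simp
    have "0 \<le> coeff (Q (Suc r)) j" if "j < 2 * r + 5" for j
    proof -
      \<comment> \<open>Only at the last two indices does the old leading coefficient -1 enter the
        sum; all others combine nonnegative coefficients.\<close>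
      have "j = 0 \<or> j = 1 \<or> j = Suc (Suc (j - 2)) \<and> j < 2 * r + 3 \<or>
          j = Suc (Suc (Suc (2 * r))) \<or> j = Suc (Suc (Suc (Suc (2 * r))))"
        using that by linarith
      then consider "j = 0" | "j = 1" | i where "j = Suc (Suc i)" "j < 2 * r + 3"
        | "j = Suc (Suc (Suc (2 * r)))" | "j = Suc (Suc (Suc (Suc (2 * r))))"
        by blast
      then show ?thesis
      proof cases
        case 4
        have "1 \<le> g * (a - real r * g)"
          using mult_mono[of 1 g 1 "a - real r * g"] Suc.prems assms(3) by (simp add: algebra_simps)
        then show ?thesis
          unfolding 4 coeff top using low[of "Suc (2 * r)"] by simp
      next
        case 5
        show ?thesis
          unfolding 5 coeff top using high[of "Suc (Suc (Suc (Suc (2 * r))))"] Suc.prems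
          by (simp add: algebra_simps)
      qed (use low assms(3) in \<open>auto simp: coeff coeff1 coeff0\<close>)
    qed
    moreover have "coeff (Q (Suc r)) j = 0" if "2 * r + 5 < j" for j
    proof -
      have "j = Suc (Suc (j - 2))" "2 * r + 3 < j - 2" using that by auto
      then show ?thesis using coeff[of "j - 2"] high by simp
    qed
    moreover have "coeff (Q (Suc r)) (2 * r + 5) = - 1"
      using coeff[of "Suc (Suc (Suc (2 * r)))"] top high by (simp add: numeral_eq_Suc)
    moreover have "coeff (Q (Suc r)) (2 * r + 4) = a - real (Suc r) * g"
      using coeff[of "Suc (Suc (2 * r))"] top high[of "Suc (Suc (Suc (Suc (2 * r))))"]
      by (simp add: numeral_eq_Suc algebra_simps)
    ultimately have "coeff (Q (Suc r)) (2 * r + 5) = - 1 \<and>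
        coeff (Q (Suc r)) (2 * r + 4) = a - real (Suc r) * g \<and>
        (\<forall>j < 2 * r + 5. 0 \<le> coeff (Q (Suc r)) j) \<and> (\<forall>j > 2 * r + 5. coeff (Q (Suc r)) j = 0)"
      by blast
    moreover have idx: "2 * Suc r + 3 = 2 * r + 5" "2 * Suc r + 2 = 2 * r + 4" by simp_all
    ultimately show ?case unfolding idx by blast
  qed
  then show "coeff q (2 * r + 3) = - 1" "coeff q (2 * r + 2) = a - real r * g"
    "\<And>j. j < 2 * r + 3 \<Longrightarrow> 0 \<le> coeff q j" "\<And>j. 2 * r + 3 < j \<Longrightarrow> coeff q j = 0"
    by (auto simp: q_def Q_def)
qed

lemma coeff_power_one_plus: "coeff ([:1, 1:] ^ K) i = (of_nat (K choose i) :: real)"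
proof (cases "i \<le> K")
  case False
  then have "degree ([:1, 1 :: real:] ^ K) < i" by (simp add: degree_linear_power)
  then show ?thesis using False by (simp add: coeff_eq_0 binomial_eq_0)
qed (simp add: coeff_linear_poly_power)

text \<open>Convolution with a binomial row, with the two top coefficients of \<open>q\<close> set
  apart since the negative one has to be outweighed by its neighbour.\<close>

lemma coeff_mult_power_one_plus:
  fixes q :: "real poly"
  assumes "\<And>j. Suc s < j \<Longrightarrow> coeff q j = 0" "0 < i"
  shows "coeff (q * [:1, 1:] ^ K) (s + i) =
    (\<Sum>j<s. coeff q j * real (K choose (s + i - j))) +
      coeff q s * real (K choose i) + coeff q (Suc s) * real (K choose (i - 1))"
proof -
  have "coeff (q * [:1, 1:] ^ K) (s + i) = (\<Sum>j\<le>s + i. coeff q j * real (K choose (s + i - j)))"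
    by (simp add: coeff_mult coeff_power_one_plus)
  also have "\<dots> = (\<Sum>j\<le>Suc s. coeff q j * real (K choose (s + i - j)))"
    using assms by (intro sum.mono_neutral_right) auto
  also have "\<dots> = (\<Sum>j<s. coeff q j * real (K choose (s + i - j))) +
      coeff q s * real (K choose i) + coeff q (Suc s) * real (K choose (i - 1))"
    using assms(2) by (simp add: atMost_Suc flip: lessThan_Suc_atMost)
  finally show ?thesis .
qed

lemma binomial_Suc_le:
  assumes "K \<le> 2 * i + 1"
  shows "K choose Suc i \<le> K choose i"
proof (cases "i < K")
  case True
  then show ?thesis using assms by (intro binomial_antimono) auto
qed (simp add: binomial_eq_0)

text \<open>With c = \<open>K choose i\<close> and u = 2 i + 1 - K, absorption turns the two
  differences into (u - 2) c / (K - i + 1) and u c / (i + 1). If u \<le> 2, the left side is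
  nonpositive and the right side positive; otherwise it is at most (u - 2) c < u c, and i + 1 \<le>
  K finishes.\<close>

lemma binomial_difference_less:
  assumes "0 < i" "i < K" "K \<le> 2 * i"
  shows "real (K choose (i - 1)) - real (K choose i) < real K * (real (K choose i) - real (K choose Suc i))"
proof -
  define c where "c = real (K choose i)"
  define u where "u = real (2 * i + 1 - K)"
  have c: "0 < c" using assms by (simp add: c_def)
  have u: "0 < u" "u = 2 * real i + 1 - real K" using assms by (auto simp: u_def of_nat_diff)
  have "Suc i * (K choose Suc i) = (K - i) * (K choose i)"
    using binomial_absorb_comp[of K i] binomial_absorption[of i K] by (simp add: mult.commute)
  then have "real (Suc i) * real (K choose Suc i) = real (K - i) * c"
    unfolding c_def by (metis of_nat_mult)
  also have "real (K - i) = real K - real i" using assms by simp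
  finally have next_eq: "(real i + 1) * (c - real (K choose Suc i)) = u * c"
    by (simp add: u algebra_simps)
  have "i * (K choose i) = (K - (i - 1)) * (K choose (i - 1))"
    using binomial_absorb_comp[of K "i - 1"] binomial_absorption[of "i - 1" K] assms(1)
    by (simp add: mult.commute)
  then have "real i * c = real (K - (i - 1)) * real (K choose (i - 1))"
    unfolding c_def by (metis of_nat_mult)
  also have "real (K - (i - 1)) = real K - real i + 1" using assms by (auto simp: of_nat_diff)
  finally have prev_eq: "(real K - real i + 1) * (real (K choose (i - 1)) - c) = (u - 2) * c"
    by (simp add: u algebra_simps)
  show ?thesis
  proof (cases "u \<le> 2")
    case True
    then have "(real K - real i + 1) * (real (K choose (i - 1)) - c) \<le> 0"
      unfolding prev_eq using c by (simp add: mult_nonpos_nonneg)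
    then have "real (K choose (i - 1)) - c \<le> 0"
      using assms by (simp add: mult_le_0_iff)
    moreover have "0 < (real i + 1) * (c - real (K choose Suc i))" unfolding next_eq using c u by simp
    then have "0 < c - real (K choose Suc i)" by (simp add: zero_less_mult_iff)
    then have "0 < real K * (c - real (K choose Suc i))" using assms by simp
    ultimately show ?thesis by (simp add: c_def)
  next
    case False
    then have "0 < (real K - real i + 1) * (real (K choose (i - 1)) - c)"
      unfolding prev_eq using c by simp
    then have "0 < real (K choose (i - 1)) - c" using assms by (simp add: zero_less_mult_iff)
    then have "real (K choose (i - 1)) - c \<le> (real K - real i + 1) * (real (K choose (i - 1)) - c)"
      using assms by (simp add: mult_le_cancel_right2)
    also have "\<dots> < u * c" unfolding prev_eq using c by simp
    also have "\<dots> = (real i + 1) * (c - real (K choose Suc i))" by (simp add: next_eq)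
    also have "\<dots> \<le> real K * (c - real (K choose Suc i))"
      using assms binomial_Suc_le[of K i] by (intro mult_right_mono) (auto simp: c_def)
    finally show ?thesis by (simp add: c_def)
  qed
qed

text \<open>Past the middle of the binomial row the contributions of the low coefficients decrease.
  For the two top ones, the drop weighted by K beats the possible rise caused by -1, by
  \<open>binomial_difference_less\<close>.\<close>

lemma tail_coeffs_mult_power_one_plus:
  fixes q :: "real poly"
  assumes low: "\<And>j. j < s \<Longrightarrow> 0 \<le> coeff q j" and "coeff q s = real K" "coeff q (Suc s) = - 1"
    and high: "\<And>j. Suc s < j \<Longrightarrow> coeff q j = 0"
    and i: "0 < i" "K \<le> 2 * i"
  shows "i < K \<Longrightarrow> coeff (q * [:1, 1:] ^ K) (s + Suc i) < coeff (q * [:1, 1:] ^ K) (s + i)"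
    and "i \<le> K \<Longrightarrow> 0 \<le> coeff (q * [:1, 1:] ^ K) (s + i)"
proof -
  show "coeff (q * [:1, 1:] ^ K) (s + Suc i) < coeff (q * [:1, 1:] ^ K) (s + i)" if "i < K"
  proof -
    have "(\<Sum>j<s. coeff q j * real (K choose (s + Suc i - j))) \<le>
        (\<Sum>j<s. coeff q j * real (K choose (s + i - j)))"
    proof (intro sum_mono mult_left_mono)
      fix j assume "j \<in> {..<s}"
      then have "s + Suc i - j = Suc (s + i - j)" "K \<le> 2 * (s + i - j) + 1" using i by auto
      then show "real (K choose (s + Suc i - j)) \<le> real (K choose (s + i - j))"
        using binomial_Suc_le by simp
    qed (use low in auto)
    then show ?thesis
      using binomial_difference_less[OF i(1) that i(2)] coeff_mult_power_one_plus[where s = s and q = q and i = i and K = K, OF high]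
        coeff_mult_power_one_plus[where s = s and q = q and i = "Suc i" and K = K, OF high] i(1) assms(2,3)
      by (simp add: algebra_simps)
  qed
  show "0 \<le> coeff (q * [:1, 1:] ^ K) (s + i)" if "i \<le> K"
  proof -
    \<comment> \<open>Absorption gives \<open>K choose (i - 1)\<close> \<le> i *
      (\<open>K choose i\<close>) \<le> K * (\<open>K choose i\<close>), so the term with -1 cannot
      make the coefficient negative.\<close>
    have "i * (K choose i) = (K - (i - 1)) * (K choose (i - 1))"
      using binomial_absorb_comp[of K "i - 1"] binomial_absorption[of "i - 1" K] i(1)
      by (simp add: mult.commute)
    moreover have "1 \<le> K - (i - 1)" using that i by linarith
    then have "K choose (i - 1) \<le> (K - (i - 1)) * (K choose (i - 1))"
      using mult_le_mono1[of 1 "K - (i - 1)" "K choose (i - 1)"] by simp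
    moreover have "i * (K choose i) \<le> K * (K choose i)" using that by simp
    ultimately have "K choose (i - 1) \<le> K * (K choose i)" by linarith
    then have "real (K choose (i - 1)) \<le> real K * real (K choose i)"
      by (metis of_nat_le_iff of_nat_mult)
    moreover have "0 \<le> (\<Sum>j<s. coeff q j * real (K choose (s + i - j)))"
      by (intro sum_nonneg) (use low in auto)
    ultimately show ?thesis
      using coeff_mult_power_one_plus[where s = s and q = q and i = i and K = K, OF high] i(1) assms(2,3) by simp
  qed
qed

lemma tail_coeffs_less:
  fixes q :: "real poly"
  assumes "\<And>j. j < s \<Longrightarrow> 0 \<le> coeff q j" "coeff q s = real K" "coeff q (Suc s) = - 1"
    "\<And>j. Suc s < j \<Longrightarrow> coeff q j = 0"
    and i: "0 < i" "K \<le> 2 * i" "i < i'" "i' \<le> K"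
  shows "\<bar>coeff (q * [:1, 1:] ^ K) (s + i')\<bar> < \<bar>coeff (q * [:1, 1:] ^ K) (s + i)\<bar>"
proof -
  note tail = tail_coeffs_mult_power_one_plus[OF assms(1-4)]
  have "coeff (q * [:1, 1:] ^ K) (s + i') < coeff (q * [:1, 1:] ^ K) (s + i)"
    using \<open>i < i'\<close> \<open>i' \<le> K\<close>
  proof (induction i')
    case (Suc k)
    then show ?case using tail(1)[of k] i by (cases "i = k") auto
  qed simp
  then show ?thesis using tail(2)[of i] tail(2)[of i'] i by simp
qed

subsection \<open>The trees and their characteristic polynomials\<close>

text \<open>
  \<open>hub_tree L M\<close> has root \<open>0\<close>, hubs \<open>1, \<dots>, L\<close> adjacent to the root, and \<open>M\<close> leaves at
  each hub; the branch of a vertex \<open>v > 0\<close> is \<open>(v - 1) mod L\<close>, and the root gets the dummy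
  branch \<open>L\<close>.
\<close>

definition hub_parent :: "nat \<Rightarrow> nat \<Rightarrow> nat" where
  "hub_parent L v = (if v \<le> L then 0 else Suc ((v - 1) mod L))"

definition branch :: "nat \<Rightarrow> nat \<Rightarrow> nat" where
  "branch L v = (if v = 0 then L else (v - 1) mod L)"

text \<open>Vectors depending only on the level (root, hub, leaf). All linear systems below have
  solutions of this form, which reduces them to three unknowns.\<close>

definition by_level :: "nat \<Rightarrow> 'a \<Rightarrow> 'a \<Rightarrow> 'a \<Rightarrow> nat \<Rightarrow> 'a" where
  "by_level L r h l v = (if v = 0 then r else if v \<le> L then h else l)"

definition hub_tree :: "nat \<Rightarrow> nat \<Rightarrow> nat pair_pre_digraph" where
  "hub_tree L M = parent_tree (Suc (L * Suc M)) (hub_parent L)"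

lemma branch_less: "0 < L \<Longrightarrow> 0 < v \<Longrightarrow> branch L v < L"
  by (simp add: branch_def)

lemma parent_function_hub_parent:
  assumes "0 < L"
  shows "parent_function (Suc (L * Suc M)) (hub_parent L)"
proof
  fix v :: nat assume "0 < v"
  have "(v - 1) mod L < L" using assms by simp
  then show "hub_parent L v < v" using \<open>0 < v\<close> by (auto simp: hub_parent_def)
qed simp

section \<open>Sums and products over the vertices of a hub tree\<close>

context comm_monoid_set
begin

text \<open>Proved for an arbitrary commutative monoid to serve sums and products alike. The
  non-root labels are cut into M + 1 blocks of length L: first the hubs, then M blocks with one leaf
  from each branch.\<close>

lemma hub_tree_vertices:
  "F g {..<Suc (L * Suc M)} =
    f (g 0) (f (F (\<lambda>i. g (Suc i)) {..<L}) (F (\<lambda>j. F (\<lambda>i. g (Suc (L + j * L + i))) {..<L}) {..<M}))"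
proof -
  have block: "F h {a..<a + k} = F (\<lambda>i. h (a + i)) {..<k}" for h and a k :: nat
    using atLeastLessThan_shift_0[of h a "a + k"] by (simp add: atLeast0LessThan comp_def)
  have "F g {..<Suc (L * Suc M)} = f (g 0) (F (\<lambda>i. g (Suc i)) {..<L * Suc M})"
    by (rule lessThan_Suc_shift)
  also have "F (\<lambda>i. g (Suc i)) {..<L * Suc M} =
      F (\<lambda>j. F (\<lambda>i. g (Suc i)) {j * L..<j * L + L}) {..<Suc M}"
    using nat_group[of "\<lambda>i. g (Suc i)" L "Suc M"] by (simp only: mult.commute)
  also have "\<dots> = F (\<lambda>j. F (\<lambda>i. g (Suc (j * L + i))) {..<L}) {..<Suc M}"
    by (simp only: block)
  also have "\<dots> = f (F (\<lambda>i. g (Suc (0 * L + i))) {..<L})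
      (F (\<lambda>j. F (\<lambda>i. g (Suc (Suc j * L + i))) {..<L}) {..<M})"
    by (rule lessThan_Suc_shift)
  finally show ?thesis by simp
qed

end

lemma branch_simps [simp]:
  "branch L 0 = L" "i < L \<Longrightarrow> branch L (Suc i) = i" "i < L \<Longrightarrow> branch L (Suc (L + j * L + i)) = i"
proof -
  show "branch L (Suc (L + j * L + i)) = i" if "i < L"
    using that mod_mult_self1[of i "Suc j" L] by (simp add: branch_def ac_simps)
qed (auto simp: branch_def)

lemma hub_parent_Suc:
  "hub_parent L (Suc i) = (if i < L then 0 else Suc (branch L (Suc i)))"
  by (auto simp: hub_parent_def branch_def)

lemma by_level_simps [simp]:
  "by_level L r h l 0 = r" "i < L \<Longrightarrow> by_level L r h l (Suc i) = h"
  "by_level L r h l (Suc (L + j * L + i)) = l"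
  by (auto simp: by_level_def)

lemma sum_hub_tree:
  fixes r :: real
  shows "(\<Sum>v<Suc (L * Suc M). by_level L r h l v) = r + real L * (h + real M * l)"
  by (subst sum.hub_tree_vertices, simp, simp add: algebra_simps)

lemma prod_hub_tree:
  fixes r :: real
  shows "(\<Prod>v<Suc (L * Suc M). by_level L r h l v) = r * h ^ L * l ^ (L * M)"
  by (subst prod.hub_tree_vertices) (simp add: power_mult mult.assoc)

lemma sum_branch:
  fixes r :: real
  assumes "a < L"
  shows "(\<Sum>v<Suc (L * Suc M). if branch L v = a then by_level L r h l v else 0) = h + real M * l"
proof -
  have "(\<Sum>i<L. if branch L (Suc i) = a then by_level L r h l (Suc i) else 0) =
      (\<Sum>i<L. if i = a then h else 0)" by (intro sum.cong) auto
  moreover have "(\<Sum>i<L. if branch L (Suc (L + j * L + i)) = a then by_level L r h l (Suc (L + j * L + i)) else 0) =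
      (\<Sum>i<L. if i = a then l else 0)" for j by (intro sum.cong) auto
  ultimately show ?thesis using assms by (subst sum.hub_tree_vertices) simp
qed

lemma sum_children:
  fixes r :: real
  assumes "0 < L" "v < Suc (L * Suc M)"
  shows "(\<Sum>k<Suc (L * Suc M). if 0 < k \<and> hub_parent L k = v then by_level L r h l k else 0) =
    by_level L (real L * h) (real M * l) 0 v"
proof -
  have 1: "(\<Sum>i<L. if 0 < Suc i \<and> hub_parent L (Suc i) = v then by_level L r h l (Suc i) else 0) =
      (\<Sum>i<L. if v = 0 then h else 0)"
    by (intro sum.cong) (auto simp: hub_parent_def)
  have 2: "(\<Sum>i<L. if 0 < Suc (L + j * L + i) \<and> hub_parent L (Suc (L + j * L + i)) = v
        then by_level L r h l (Suc (L + j * L + i)) else 0) =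
      (\<Sum>i<L. if v = Suc i then l else 0)" for j
    by (intro sum.cong) (auto simp: hub_parent_Suc)
  have 3: "(\<Sum>i<L. if v = Suc i then l else 0) = (if 0 < v \<and> v \<le> L then l else 0)"
    by (cases v) auto
  show ?thesis
    by (subst sum.hub_tree_vertices) (simp only: 1 2 3, auto simp: by_level_def)
qed

section \<open>Distances in a hub tree\<close>

text \<open>Sum of the depths, shortened by 2 within a branch because the path turns at the hub. The
  subtraction does not truncate there: distinct vertices of one branch have depths summing to at
  least 3.\<close>

definition hub_dist :: "nat \<Rightarrow> nat \<Rightarrow> nat \<Rightarrow> nat" where
  "hub_dist L u v = (if u = v then 0
     else by_level L 0 1 2 u + by_level L 0 1 2 v - (if branch L u = branch L v then 2 else 0))"

lemma graph_dist_hub_tree: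
  assumes "0 < L" "u < Suc (L * Suc M)" "v < Suc (L * Suc M)"
  shows "graph_dist (hub_tree L M) u v = hub_dist L u v"
proof -
  note tree = parent_function_hub_parent[OF assms(1), of M]
  have hub_cases: "0 < w \<Longrightarrow> w \<le> L \<Longrightarrow> w = Suc (branch L w)" for w
    by (auto simp: branch_def)
  have leaf_parent: "L < w \<Longrightarrow> hub_parent L w = Suc (branch L w)" for w
    by (simp add: hub_parent_def branch_def)
  have bl: "branch L w < L" if "0 < w" for w using branch_less assms(1) that by simp
  have arcs: "(a, b) \<in> parcs (hub_tree L M) \<longleftrightarrow> a < Suc (L * Suc M) \<and> b < Suc (L * Suc M) \<and>
     (0 < b \<and> a = hub_parent L b \<or> 0 < a \<and> b = hub_parent L a)" for a b
    by (simp add: hub_tree_def)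
  \<comment> \<open>Both inequalities are proved since every arc leads either to a parent or to a
    child.\<close>
  have up: "hub_dist L a w \<le> Suc (hub_dist L (hub_parent L a) w) \<and>
    hub_dist L (hub_parent L a) w \<le> Suc (hub_dist L a w)" if "0 < a" for a w
  proof (cases "a \<le> L")
    case True
    then show ?thesis using that hub_cases[of a] hub_cases[of w] bl[of a] bl[of w] assms(1)
      by (cases "w = 0"; cases "a = w") (auto simp: hub_dist_def hub_parent_def by_level_def)
  next
    case False
    then show ?thesis using that leaf_parent[of a] hub_cases[of w] bl[of a] bl[of w]
      by (auto simp: hub_dist_def by_level_def)
  qed
  show ?thesis
  proof (rule graph_dist_eqI)
    show "pair_wf_digraph (hub_tree L M)"
      using parent_function.pair_graph_parent_tree[OF tree] unfolding hub_tree_def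
      by (intro pair_graph.axioms pair_digraph.axioms pair_fin_digraph.axioms) (auto dest: pair_graph.axioms)
    show "hub_dist L a w \<le> Suc (hub_dist L b w)" if "(a, b) \<in> parcs (hub_tree L M)" for a b w
      using that up[of a w] up[of b w] by (auto simp: arcs)
    show "\<exists>a'. (a, a') \<in> parcs (hub_tree L M) \<and> hub_dist L a w = Suc (hub_dist L a' w)"
      if "a \<in> pverts (hub_tree L M)" "w \<in> pverts (hub_tree L M)" "a \<noteq> w" for a w
    proof -
      have aw: "a < Suc (L * Suc M)" "w < Suc (L * Suc M)" using that by (auto simp: hub_tree_def)
      \<comment> \<open>The next vertex on the way to \<open>w\<close>: from the root, the hub of
        the branch of \<open>w\<close>; from a hub, its leaf \<open>w\<close> or else the root; from
        a leaf, its hub.\<close>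
      consider "a = 0" | "0 < a" "a \<le> L" "branch L w = branch L a" | "0 < a" "a \<le> L" "branch L w \<noteq> branch L a" | "L < a"
        by linarith
      then show ?thesis
      proof cases
        case 1
        then show ?thesis using aw that(3) bl[of w] hub_cases[of w] assms(1)
          by (intro exI[of _ "Suc (branch L w)"]) (auto simp: arcs hub_parent_def hub_dist_def by_level_def)
      next
        case 2
        then have "branch L w < L" using bl[of a] by simp
        then have "w \<noteq> 0" by (metis branch_simps(1) less_irrefl)
        with 2 show ?thesis using aw that(3) bl[of a] hub_cases[of a] hub_cases[of w] leaf_parent[of w]
          by (intro exI[of _ w]) (auto simp: arcs hub_dist_def by_level_def)
      next
        case 3
        then show ?thesis using aw bl[of a] bl[of w]
          by (cases "w = 0"; intro exI[of _ 0]) (auto simp: arcs hub_parent_def hub_dist_def by_level_def)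
      next
        case 4
        then show ?thesis using aw that(3) bl[of a] leaf_parent[of a] hub_cases[of w] parent_function.parent_less[OF tree, of a]
          by (intro exI[of _ "hub_parent L a"]) (auto simp: arcs hub_dist_def by_level_def)
      qed
    qed
  qed (use assms in \<open>auto simp: hub_dist_def hub_tree_def\<close>)
qed

section \<open>Evaluating the two characteristic polynomials\<close>

lemma poly_det: "poly (det A) x = det (map_mat (\<lambda>q. poly q x) A)" for A :: "'a :: comm_ring_1 poly mat"
proof -
  have "comm_ring_hom (\<lambda>q :: 'a poly. poly q x)" by unfold_locales auto
  then show ?thesis by (rule comm_ring_hom.hom_det[symmetric])
qed

lemma poly_CPA:
  "poly (CPA T) x = det (mat (card (pverts T)) (card (pverts T))
     (\<lambda>(i, j). (if i = j then x else 0) - (if (i, j) \<in> parcs T then 1 else 0)))"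
  unfolding CPA_def char_poly_defs poly_det
  by (intro arg_cong[of _ _ det] eq_matI) (auto simp: adjacency_matrix_def)

lemma poly_CPD:
  "poly (CPD T) x = det (mat (card (pverts T)) (card (pverts T))
     (\<lambda>(i, j). real (graph_dist T i j) - (if i = j then x else 0)))"
  unfolding CPD_def poly_det
  by (intro arg_cong[of _ _ det] eq_matI) (auto simp: distance_matrix_def)

text \<open>Successors for L and M make the exponents L - 1 and M - 1 available as \<open>l\<close>
  and \<open>m\<close>, free of truncated subtraction.\<close>

context
  fixes l m L M N :: nat
  defines "L \<equiv> Suc l" and "M \<equiv> Suc m" and "N \<equiv> Suc (L * Suc M)"
begin

lemma card_hub_tree: "card (pverts (hub_tree L M)) = N"
  by (simp add: hub_tree_def N_def)

text \<open>Tree elimination has pivots x at leaves, h = x - M / x at hubs and r = x - L / h at the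
  root. Writing x^2 - M as -(M + y) with y = -x^2 leaves a polynomial in y with positive
  coefficients, as \<open>coeffs_decay\<close> requires.\<close>

lemma CPA_hub_tree:
  "CPA (hub_tree L M) = monom ((- 1) ^ L) (Suc (L * m)) *
     pcompose ([:real M, 1:] ^ l * [:real M + real L, 1:]) (monom (- 1) 2)"
proof (rule poly_eqI_above)
  \<comment> \<open>The bound gives x^2 > M + L, which makes all three kinds of pivots
    positive.\<close>
  fix x :: real assume x: "real (M + L) + 1 < x"
  interpret parent_function N "hub_parent L"
    unfolding N_def by (rule parent_function_hub_parent) (simp add: L_def)
  have "x * 1 \<le> x * x" using x by (intro mult_left_mono) auto
  then have x2: "real M + real L < x * x" using x by linarith
  define h where "h = x - real M / x"
  define r where "r = x - real L / h"
  define d where "d = by_level L r h x"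
  have x0: "0 < x" using x by simp
  have xh: "x * h = x * x - real M" using x0 by (simp add: h_def field_simps)
  have "0 < x * h" unfolding xh using x2 by linarith
  then have h0: "0 < h" using x0 by (simp add: zero_less_mult_iff)
  have xhr: "h * r = x * h - real L" using h0 by (simp add: r_def field_simps)
  then have "0 < h * r" using x2 xh by simp
  then have r0: "0 < r" using h0 by (simp add: zero_less_mult_iff)
  have "det (mat N N (\<lambda>(i, j). (if i = j then x else 0) -
    (if 0 < j \<and> i = hub_parent L j \<or> 0 < i \<and> j = hub_parent L i then 1 else 0))) = (\<Prod>v<N. d v)"
  proof (rule det_tree_elimination)
    fix v assume v: "v < N"
    show "d v \<noteq> 0" using x0 h0 r0 by (auto simp: d_def by_level_def)
    have "(\<Sum>k<N. if 0 < k \<and> hub_parent L k = v then 1 / d k else 0) =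
        (\<Sum>k<N. if 0 < k \<and> hub_parent L k = v then by_level L (1 / r) (1 / h) (1 / x) k else 0)"
      by (intro sum.cong) (auto simp: d_def by_level_def)
    also have "\<dots> = by_level L (real L * (1 / h)) (real M * (1 / x)) 0 v"
      unfolding N_def using v by (intro sum_children) (auto simp: L_def N_def)
    finally show "d v + (\<Sum>k<N. if 0 < k \<and> hub_parent L k = v then 1 / d k else 0) = x"
      by (simp add: d_def by_level_def h_def r_def)
  qed (rule parent_less)
  moreover have "mat N N (\<lambda>(i, j). (if i = j then x else 0) -
    (if 0 < j \<and> i = hub_parent L j \<or> 0 < i \<and> j = hub_parent L i then 1 else 0)) =
    mat N N (\<lambda>(i, j). (if i = j then x else 0) - (if (i, j) \<in> parcs (hub_tree L M) then 1 else 0))"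
    by (intro eq_matI) (auto simp: hub_tree_def N_def)
  ultimately have "poly (CPA (hub_tree L M)) x = (\<Prod>v<N. d v)"
    by (simp add: poly_CPA card_hub_tree)
  also have "\<dots> = r * h ^ L * x ^ (L * M)"
    unfolding d_def N_def by (rule prod_hub_tree)
  also have "\<dots> = x ^ Suc (L * m) * (x * h) ^ l * (x * (h * r)) / x"
    using x0 by (simp add: L_def M_def power_mult_distrib power_add field_simps)
  also have "\<dots> = x ^ Suc (L * m) * (x * x - real M) ^ l * (x * x - real M - real L)"
    using x0 by (simp add: xh xhr)
  also have "\<dots> = x ^ Suc (L * m) * ((- 1) * (real M - x * x)) ^ l * ((- 1) * (real M + real L - x * x))"
    by (simp add: algebra_simps)
  also have "\<dots> = (- 1) ^ L * x ^ Suc (L * m) * (real M - x * x) ^ l * (real M + real L - x * x)"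
    unfolding power_mult_distrib by (simp only: L_def power_Suc mult_ac)
  finally show "poly (CPA (hub_tree L M)) x = poly (monom ((- 1) ^ L) (Suc (L * m)) *
     pcompose ([:real M, 1:] ^ l * [:real M + real L, 1:]) (monom (- 1) 2)) x"
    by (simp add: poly_pcompose poly_monom power2_eq_square) (simp add: algebra_simps)
qed

text \<open>D - x I is the negative of c - h 1^T - 1 h^T, where \<open>h\<close> is the depth and
  \<open>c\<close> is diagonal plus a block of twos for each branch. The block formula gives det c,
  and the rank two update the rest.\<close>

lemma CPD_hub_tree:
  "CPD (hub_tree L M) = Polynomial.smult ((- 1) ^ N) ([:2, 1:] ^ (L * m) * [:4, 2 * real M + 4, 1:] ^ l *
     [:- 2 * real L * (1 + real M), 4 - 5 * real L - 4 * real L * real M - real L ^ 2 * real M,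
       4 + 2 * real M - 2 * real L - 4 * real L * real M, 1:])"
proof (rule poly_eqI_above)
  \<comment> \<open>This bound yields \<beta> < 1 below, the non-degeneracy condition of the rank
    two update.\<close>
  fix x :: real assume x: "real L + 2 * real L * real M < x"
  have L0: "0 < L" by (simp add: L_def)
  have x0: "0 < x" using x by (intro le_less_trans[OF _ x]) auto
  \<comment> \<open>W / (x (x + 2)) is the factor that one branch contributes to det c.\<close>
  define W where "W = x\<^sup>2 + (2 * real M + 4) * x + 4"
  have W0: "0 < W" using x0 by (auto simp: W_def intro!: add_nonneg_pos)
  define \<delta> where "\<delta> = by_level L x x (x + 2)"
  define h where "h = by_level L 0 1 (2 :: real)"
  define c where "c i j = (if i = j then \<delta> i else 0) +
    (if branch L i = branch L j \<and> branch L i < L then 2 else 0)" for i j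
  \<comment> \<open>\<open>w\<close> and \<open>y\<close> solve c w = 1 and c y = h. Within a branch
    these are 2 by 2 systems for the hub and leaf values, with denominator W.\<close>
  define w where "w = by_level L (1 / x) ((x + 2) / W) (x / W)"
  define y where "y = by_level L 0 ((x + 2 - 2 * real M) / W) (2 * (x + 1) / W)"
  have \<delta>0: "\<delta> i \<noteq> 0" for i using x0 by (auto simp: \<delta>_def by_level_def)
  have row: "(\<Sum>k<N. c i k * by_level L r' h' l' k) =
    \<delta> i * by_level L r' h' l' i + (if 0 < i then 2 * (h' + real M * l') else 0)" if "i < N" for i r' h' l'
  proof -
    have "(\<Sum>k<N. c i k * by_level L r' h' l' k) = (\<Sum>k<N. if k = i then \<delta> i * by_level L r' h' l' i else 0) +
      (\<Sum>k<N. if branch L i < L then 2 * (if branch L k = branch L i then by_level L r' h' l' k else 0) else 0)"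
      unfolding sum.distrib[symmetric] by (intro sum.cong) (auto simp: c_def algebra_simps)
    also have "(\<Sum>k<N. if branch L i < L then 2 * (if branch L k = branch L i then by_level L r' h' l' k else 0) else 0)
      = (if 0 < i then 2 * (h' + real M * l') else 0)"
      using branch_less[OF L0, of i] unfolding N_def
      by (cases "i = 0") (simp_all only: sum_distrib_left[symmetric] sum_branch if_True branch_simps, simp_all)
    finally show ?thesis using that by simp
  qed
  have w: "(\<Sum>k<N. c i k * w k) = 1" if "i < N" for i
    unfolding w_def row[OF that] using x0 W0
    by (auto simp: \<delta>_def by_level_def field_simps) (auto simp: W_def power2_eq_square algebra_simps)
  have y: "(\<Sum>k<N. c i k * y k) = h i" if "i < N" for i
    unfolding y_def row[OF that] using x0 W0
    by (auto simp: \<delta>_def h_def by_level_def field_simps) (auto simp: W_def power2_eq_square algebra_simps)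
  define \<beta> where "\<beta> = real L * ((x + 2) + 2 * real M * x) / W"
  define \<alpha> where "\<alpha> = real L * ((x + 2 - 2 * real M) + 4 * real M * (x + 1)) / W"
  define \<gamma> where "\<gamma> = 1 / x + real L * ((x + 2) + real M * x) / W"
  have hw: "(\<Sum>k<N. h k * w k) = \<beta>"
  proof -
    have "(\<Sum>k<N. h k * w k) = (\<Sum>k<N. by_level L 0 ((x + 2) / W) (2 * x / W) k)"
      by (intro sum.cong) (auto simp: h_def w_def by_level_def)
    also have "\<dots> = 0 + real L * ((x + 2) / W + real M * (2 * x / W))"
      unfolding N_def by (rule sum_hub_tree)
    also have "\<dots> = \<beta>" using W0 by (simp add: \<beta>_def field_simps)
    finally show ?thesis .
  qed
  have hy: "(\<Sum>k<N. h k * y k) = \<alpha>"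
  proof -
    have "(\<Sum>k<N. h k * y k) = (\<Sum>k<N. by_level L 0 ((x + 2 - 2 * real M) / W) (4 * (x + 1) / W) k)"
      by (intro sum.cong) (auto simp: h_def y_def by_level_def)
    also have "\<dots> = 0 + real L * ((x + 2 - 2 * real M) / W + real M * (4 * (x + 1) / W))"
      unfolding N_def by (rule sum_hub_tree)
    also have "\<dots> = \<alpha>" using W0 by (simp add: \<alpha>_def field_simps)
    finally show ?thesis .
  qed
  have sw: "(\<Sum>k<N. w k) = \<gamma>"
    unfolding N_def w_def sum_hub_tree using W0 x0 by (simp add: \<gamma>_def field_simps)
  \<comment> \<open>The sum of \<open>y\<close> equals the pairing of \<open>h\<close> with
    \<open>w\<close> by symmetry of c, hence the square (1 - \<beta>)^2.\<close>
  have sy: "(\<Sum>k<N. y k) = \<beta>"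
    unfolding N_def y_def sum_hub_tree using W0 by (simp add: \<beta>_def field_simps)
  have "\<beta> < 1"
  proof -
    have "real L * ((x + 2) + 2 * real M * x) = (real L + 2 * real L * real M) * x + 2 * real L"
      by (simp add: algebra_simps)
    also have "\<dots> < x * x + 2 * x"
      using mult_strict_right_mono[OF x x0] x by (intro add_strict_mono) (auto intro: le_less_trans[rotated])
    also have "\<dots> < W" using x0 by (simp add: W_def power2_eq_square algebra_simps add_pos_nonneg)
    finally show ?thesis using W0 by (simp add: \<beta>_def)
  qed
  then have "det (mat N N (\<lambda>(i, j). c i j - h i - h j)) = det (mat N N (\<lambda>(i, j). c i j)) *
      ((1 - \<beta>) * (1 - \<beta>) - \<alpha> * \<gamma>)"
    using det_rank_two_update[OF w y] by (simp add: hw hy sw sy)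
  also have "det (mat N N (\<lambda>(i, j). c i j)) = x * ((x + 2) ^ (L * m) * W ^ L)"
  proof -
    have "det (mat N N (\<lambda>(i, j). c i j)) =
      (\<Prod>i<N. \<delta> i) * (\<Prod>a<L. 1 + 2 * (\<Sum>k<N. if branch L k = a then 1 / \<delta> k else 0))"
      unfolding c_def by (rule det_diagonal_plus_blocks) (rule \<delta>0)
    also have "(\<Prod>a<L. 1 + 2 * (\<Sum>k<N. if branch L k = a then 1 / \<delta> k else 0)) =
      (\<Prod>a<L. 1 + 2 * (1 / x + real M * (1 / (x + 2))))"
    proof (intro prod.cong refl)
      fix a assume "a \<in> {..<L}"
      have "(\<Sum>k<N. if branch L k = a then 1 / \<delta> k else 0) =
        (\<Sum>k<N. if branch L k = a then by_level L (1 / x) (1 / x) (1 / (x + 2)) k else 0)"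
        by (intro sum.cong) (auto simp: \<delta>_def by_level_def)
      also have "\<dots> = 1 / x + real M * (1 / (x + 2))"
        unfolding N_def using \<open>a \<in> {..<L}\<close> by (intro sum_branch) simp
      finally show "1 + 2 * (\<Sum>k<N. if branch L k = a then 1 / \<delta> k else 0) =
        1 + 2 * (1 / x + real M * (1 / (x + 2)))" by simp
    qed
    also have "\<dots> = (1 + 2 * (1 / x + real M * (1 / (x + 2)))) ^ L" by simp
    also have "1 + 2 * (1 / x + real M * (1 / (x + 2))) = W / (x * (x + 2))"
      using x0 add_pos_pos[of "x * x" "x * 2"] by (simp add: W_def field_simps power2_eq_square)
    also have "(\<Prod>i<N. \<delta> i) = x * x ^ L * (x + 2) ^ (L * M)"
      unfolding \<delta>_def N_def by (rule prod_hub_tree)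
    also have "x * x ^ L * (x + 2) ^ (L * M) * (W / (x * (x + 2))) ^ L = x * ((x + 2) ^ (L * m) * W ^ L)"
    proof -
      have split: "x * x ^ L * (x + 2) ^ (L * M) = x * (x * (x + 2)) ^ L * (x + 2) ^ (L * m)"
        by (simp add: M_def power_mult_distrib power_add)
      show ?thesis unfolding split using x0 by (simp add: power_divide)
    qed
    finally show ?thesis .
  qed
  also have "x * ((x + 2) ^ (L * m) * W ^ L) * ((1 - \<beta>) * (1 - \<beta>) - \<alpha> * \<gamma>) =
      (x + 2) ^ (L * m) * W ^ l * (x * W * ((1 - \<beta>) * (1 - \<beta>) - \<alpha> * \<gamma>))"
    by (simp add: L_def)
  also have "x * W * ((1 - \<beta>) * (1 - \<beta>) - \<alpha> * \<gamma>) =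
     - 2 * real L * (1 + real M) + x * (4 - 5 * real L - 4 * real L * real M - real L ^ 2 * real M
       + x * (4 + 2 * real M - 2 * real L - 4 * real L * real M + x))" (is "_ = ?T")
  proof -
    \<comment> \<open>The extra factor W clears the last denominator. The resulting polynomial of
      degree 5 is divisible by W, so cancelling W leaves the cubic.\<close>
    have "x * W * ((1 - \<beta>) * (1 - \<beta>) - \<alpha> * \<gamma>) * W = ?T * W"
    proof -
      have "x * W * ((1 - \<beta>) * (1 - \<beta>) - \<alpha> * \<gamma>) * W =
        x * ((W - W * \<beta>) * (W - W * \<beta>)) - (W * \<alpha>) * (x * W * \<gamma>)"
        by (simp add: algebra_simps)
      also have "W * \<beta> = real L * ((x + 2) + 2 * real M * x)" using W0 by (simp add: \<beta>_def)
      also have "W * \<alpha> = real L * ((x + 2 - 2 * real M) + 4 * real M * (x + 1))" using W0 by (simp add: \<alpha>_def)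
      also have "x * W * \<gamma> = W + x * real L * ((x + 2) + real M * x)" using W0 x0 by (simp add: \<gamma>_def field_simps)
      finally show ?thesis by (simp add: W_def power2_eq_square algebra_simps)
    qed
    then show ?thesis using W0 by simp
  qed
  finally have C: "det (mat N N (\<lambda>(i, j). c i j - h i - h j)) = (x + 2) ^ (L * m) * W ^ l * ?T" .
  have "mat N N (\<lambda>(i, j). real (graph_dist (hub_tree L M) i j) - (if i = j then x else 0)) =
    (- 1) \<cdot>\<^sub>m mat N N (\<lambda>(i, j). c i j - h i - h j)"
  proof -
    have dist: "real (hub_dist L i j) =
      (if i = j then 0 else h i + h j - (if branch L i = branch L j \<and> branch L i < L then 2 else 0))" for i j
      using branch_less[OF L0, of i] branch_less[OF L0, of j]
      by (cases "i = 0"; cases "j = 0") (auto simp: hub_dist_def h_def by_level_def of_nat_diff)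
    have "real (hub_dist L i j) - (if i = j then x else 0) = - (c i j - h i - h j)" for i j
      unfolding dist using branch_less[OF L0, of i]
      by (cases "i = j"; cases "i = 0") (simp_all add: c_def h_def \<delta>_def by_level_def)
    then show ?thesis
      by (intro eq_matI) (simp_all add: graph_dist_hub_tree[OF L0] N_def)
  qed
  then have "poly (CPD (hub_tree L M)) x = (- 1) ^ N * ((x + 2) ^ (L * m) * W ^ l * ?T)"
    by (simp add: poly_CPD card_hub_tree C)
  moreover have "poly [:2, 1:] x = x + 2" by simp
  moreover have "poly [:4, 2 * real M + 4, 1:] x = W"
    by (simp add: W_def power2_eq_square algebra_simps)
  moreover have "poly [:- 2 * real L * (1 + real M), 4 - 5 * real L - 4 * real L * real M - real L ^ 2 * real M,
       4 + 2 * real M - 2 * real L - 4 * real L * real M, 1:] x = ?T"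
    by simp
  ultimately show "poly (CPD (hub_tree L M)) x = poly (Polynomial.smult ((- 1) ^ N)
    ([:2, 1:] ^ (L * m) * [:4, 2 * real M + 4, 1:] ^ l *
     [:- 2 * real L * (1 + real M), 4 - 5 * real L - 4 * real L * real M - real L ^ 2 * real M,
       4 + 2 * real M - 2 * real L - 4 * real L * real M, 1:])) x"
    by (simp only: poly_smult poly_mult poly_power)
qed

end

subsection \<open>The peaks\<close>

context
  fixes l m L M :: nat
  defines "L \<equiv> Suc l" and "M \<equiv> Suc m"
begin

lemma abs_coeff_CPA_hub_tree:
  "\<bar>coeff (CPA (hub_tree L M)) n\<bar> = (if Suc (L * m) \<le> n \<and> even (n - Suc (L * m))
     then \<bar>coeff ([:real M, 1:] ^ l * [:real M + real L, 1:]) ((n - Suc (L * m)) div 2)\<bar> else 0)"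
  unfolding L_def M_def CPA_hub_tree
  by (simp only: coeff_monom_mult coeff_pcompose_monom_square abs_mult power_abs abs_minus abs_one power_one)
     (auto simp: abs_mult power_abs)

lemma coeffs_decay_CPA_hub_tree:
  "coeffs_decay (real M) L ([:real M, 1:] ^ l * [:real M + real L, 1:])"
  unfolding L_def by (intro coeffs_decay_mult coeffs_decay_power) (auto simp: M_def)

lemma CPA_support_hub_tree:
  "{i. coeff (CPA (hub_tree L M)) i \<noteq> 0} = (\<lambda>i. Suc (L * m) + 2 * i) ` {..<Suc L}"
proof -
  let ?R = "[:real M, 1:] ^ l * [:real M + real L, 1:]"
  have R: "coeff ?R i \<noteq> 0 \<longleftrightarrow> i < Suc L" for i
    using coeffs_decay_CPA_hub_tree unfolding coeffs_decay_def
    by (metis less_Suc_eq_le less_irrefl not_le)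
  have "coeff (CPA (hub_tree L M)) n \<noteq> 0 \<longleftrightarrow>
      Suc (L * m) \<le> n \<and> even (n - Suc (L * m)) \<and> (n - Suc (L * m)) div 2 < Suc L" for n
    using abs_coeff_CPA_hub_tree[of n] R[of "(n - Suc (L * m)) div 2"] by (auto split: if_splits)
  moreover have "n \<in> (\<lambda>i. Suc (L * m) + 2 * i) ` {..<Suc L} \<longleftrightarrow>
      Suc (L * m) \<le> n \<and> even (n - Suc (L * m)) \<and> (n - Suc (L * m)) div 2 < Suc L" for n
  proof
    assume "Suc (L * m) \<le> n \<and> even (n - Suc (L * m)) \<and> (n - Suc (L * m)) div 2 < Suc L"
    then show "n \<in> (\<lambda>i. Suc (L * m) + 2 * i) ` {..<Suc L}"
      by (intro image_eqI[of _ _ "(n - Suc (L * m)) div 2"]) auto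
  qed auto
  ultimately show ?thesis by blast
qed

lemma num_terms_A_hub_tree: "num_terms_A (hub_tree L M) = Suc L"
  unfolding num_terms_A_def CPA_support_hub_tree by (subst card_image) (auto intro: inj_onI)

lemma CPA_exponents_hub_tree:
  "CPA_exponents (hub_tree L M) = map (\<lambda>i. Suc (L * m) + 2 * i) [0..<Suc L]"
  unfolding CPA_exponents_def CPA_support_hub_tree
  by (rule sorted_list_of_set_unique[THEN iffD1]) 
     (auto simp: sorted_wrt_map atLeast0LessThan card_image inj_on_def sorted_wrt_iff_nth_less simp del: upt_Suc)

text \<open>The decay ratio is at most L / M < 1, so the lowest coefficient is the unique maximum
  and the choice made by \<open>arg_max\<close> is forced to index 0, that is, position 1.\<close>

lemma peak_A_hub_tree:
  assumes "L < M"
  shows "peak_A (hub_tree L M) = 1"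
proof -
  define R where "R = [:real M, 1:] ^ l * [:real M + real L, 1:]"
  note decay = coeffs_decay_CPA_hub_tree[folded R_def]
  let ?f = "\<lambda>i. \<bar>coeff (CPA (hub_tree L M)) (CPA_exponents (hub_tree L M) ! i)\<bar>"
  have f: "?f i = coeff R i" if "i < Suc L" for i
  proof -
    have "0 < coeff R i" using that decay by (auto simp: coeffs_decay_def)
    then show ?thesis
      using that by (simp add: CPA_exponents_hub_tree abs_coeff_CPA_hub_tree[folded R_def] del: upt_Suc)
  qed
  have "arg_max ?f (\<lambda>i. i < num_terms_A (hub_tree L M)) = 0"
  proof (rule ccontr)
    let ?a = "arg_max ?f (\<lambda>i. i < num_terms_A (hub_tree L M))"
    assume a0: "?a \<noteq> 0"
    note max = arg_max_on_finite[where f = ?f and P = "\<lambda>i. i < num_terms_A (hub_tree L M)" and a = 0]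
    have "?a < Suc L" "?f 0 \<le> ?f ?a"
      using max by (auto simp: num_terms_A_hub_tree)
    then have "coeff R 0 \<le> coeff R ?a" using f[of ?a] f[of 0] by simp
    moreover have "coeff R ?a < coeff R 0"
      using a0 assms by (intro coeffs_decay_less[OF decay]) auto
    ultimately show False by simp
  qed
  then show ?thesis by (simp add: peak_A_def)
qed

lemma peak_D_hub_tree:
  assumes "2 \<le> L * m"
  shows "2 * peak_D (hub_tree L M) \<le> 4 * L + L * m + 1"
proof -
  define K N where "K = L * m" and "N = Suc (L * Suc M)"
  \<comment> \<open>-8 times the cubic with coefficients c, b, a, -1 is the cubic factor of
    \<open>CPD\<close> at 2 x.\<close>
  define a where "a = 2 * real L * real M + real L - real M - 2"
  define b where "b = (real L ^ 2 * real M + 4 * real L * real M + 5 * real L - 4) / 4"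
  define c where "c = real L * (1 + real M) / 4"
  define q where "q = [:c, b, a, - 1:] * [:1, real M + 2, 1:] ^ l"
  define s where "s = 2 * L"
  have N: "N = s + K + 1" by (simp add: N_def s_def K_def M_def)
  \<comment> \<open>The coefficient of \<open>q\<close> next to the leading one is exactly the
    exponent of 1 + x, as the tail lemmas demand.\<close>
  have aK: "a - real l * (real M + 2) = real K"
    by (simp add: a_def K_def L_def M_def algebra_simps)
  have K2: "2 \<le> K" using assms by (simp add: K_def)
  have b0: "0 \<le> b" by (simp add: b_def L_def M_def)
  have c0: "0 \<le> c" by (simp add: c_def)
  have g1: "1 \<le> real M + 2" by simp
  have al: "real l * (real M + 2) + 1 \<le> a" using aK K2 by linarith
  have idx: "2 * l + 3 = Suc s" "2 * l + 2 = s" by (simp_all add: s_def L_def)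
  note q = cubic_times_quadratic_power_coeffs[OF b0 c0 g1 al, folded q_def, unfolded idx aK]
  have low: "0 \<le> coeff q j" if "j < s" for j by (rule q(3)) (use that in simp)
  note CPD = CPD_hub_tree[of l m, folded L_def M_def]
  \<comment> \<open>The constants split off by x = 2 y: 2 from each linear factor, 4 from each
    quadratic factor and -8 from the cubic.\<close>
  define C where "C = (- 1) ^ N * 2 ^ K * 4 ^ l * (- 8 :: real)"
  have "pcompose (CPD (hub_tree L M)) [:0, 2:] = Polynomial.smult C (q * [:1, 1:] ^ K)"
  proof (rule poly_eqI_above[of 0])
    fix x :: real
    let ?T = "- 2 * real L * (1 + real M) + 2 * x * (4 - 5 * real L - 4 * real L * real M - real L ^ 2 * real M
       + 2 * x * (4 + 2 * real M - 2 * real L - 4 * real L * real M + 2 * x))"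
    have "poly (pcompose (CPD (hub_tree L M)) [:0, 2:]) x =
      (- 1) ^ N * ((2 * (1 + x)) ^ K * (4 * (1 + x * (real M + 2 + x))) ^ l * ?T)"
    proof -
      have "poly [:0, 2:] x = 2 * x" "poly [:2, 1:] (2 * x) = 2 * (1 + x)"
        "poly [:4, 2 * real M + 4, 1:] (2 * x) = 4 * (1 + x * (real M + 2 + x))"
        "poly [:- 2 * real L * (1 + real M), 4 - 5 * real L - 4 * real L * real M - real L ^ 2 * real M,
          4 + 2 * real M - 2 * real L - 4 * real L * real M, 1:] (2 * x) = ?T"
        by (simp_all add: algebra_simps)
      then show ?thesis
        unfolding K_def N_def CPD poly_pcompose by (simp only: poly_smult poly_mult poly_power)
    qed
    also have "?T = - 8 * (c + x * (b + x * (a - x)))"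
      by (simp add: a_def b_def c_def field_simps power2_eq_square)
    finally have lhs: "poly (pcompose (CPD (hub_tree L M)) [:0, 2:]) x = (- 1) ^ N *
      ((2 * (1 + x)) ^ K * (4 * (1 + x * (real M + 2 + x))) ^ l * (- 8 * (c + x * (b + x * (a - x)))))" .
    have "poly [:c, b, a, - 1:] x = c + x * (b + x * (a - x))"
      "poly [:1, real M + 2, 1:] x = 1 + x * (real M + 2 + x)" "poly [:1, 1:] x = 1 + x"
      by simp_all
    then have "poly (Polynomial.smult C (q * [:1, 1:] ^ K)) x =
      C * ((c + x * (b + x * (a - x))) * (1 + x * (real M + 2 + x)) ^ l * (1 + x) ^ K)"
      unfolding q_def by (simp only: poly_smult poly_mult poly_power)
    then show "poly (pcompose (CPD (hub_tree L M)) [:0, 2:]) x = poly (Polynomial.smult C (q * [:1, 1:] ^ K)) x"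
      unfolding lhs C_def by (simp only: power_mult_distrib mult_ac)
  qed
  then have coeff: "2 ^ k * coeff (CPD (hub_tree L M)) k = C * coeff (q * [:1, 1:] ^ K) k" for k
    by (metis coeff_pcompose_linear coeff_smult)
  have card: "card (pverts (hub_tree L M)) = N" by (simp add: hub_tree_def N_def)
  have norm: "normalized_coeff_D (hub_tree L M) k =
      \<bar>C\<bar> / 2 ^ (N - 2) * \<bar>coeff (q * [:1, 1:] ^ K) k\<bar>" for k
  proof -
    have "\<bar>2 ^ k * coeff (CPD (hub_tree L M)) k\<bar> = \<bar>C * coeff (q * [:1, 1:] ^ K) k\<bar>"
      using coeff by simp
    then show ?thesis by (simp add: normalized_coeff_D_def card abs_mult)
  qed
  have Cpos: "0 < \<bar>C\<bar> / 2 ^ (N - 2)" by (simp add: C_def)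
  let ?p = "peak_D (hub_tree L M)"
  let ?P = "\<lambda>k. k \<le> N - 2"
  \<comment> \<open>Half of K rounded up, the first index from which the tail is known to
    decrease.\<close>
  define i where "i = (K + 1) div 2"
  have i: "0 < i" "K \<le> 2 * i" "i < K" "2 * i \<le> K + 1" using assms by (auto simp: i_def K_def)
  have "?p \<le> s + i"
  proof (rule ccontr)
    assume "\<not> ?p \<le> s + i"
    then have p: "s + i < ?p" by simp
    have si: "?P (s + i)" using i N by simp
    note max = arg_max_on_finite[where f = "normalized_coeff_D (hub_tree L M)" and P = ?P, OF _ si]
    have pN: "?p \<le> N - 2" and le: "normalized_coeff_D (hub_tree L M) (s + i) \<le> normalized_coeff_D (hub_tree L M) ?p"
      using max si by (auto simp: peak_D_def card)
    have "\<bar>coeff (q * [:1, 1:] ^ K) (s + (?p - s))\<bar> < \<bar>coeff (q * [:1, 1:] ^ K) (s + i)\<bar>"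
      by (rule tail_coeffs_less[OF low q(2,1,4)]) (use i p pN N in linarith)+
    then have "normalized_coeff_D (hub_tree L M) ?p < normalized_coeff_D (hub_tree L M) (s + i)"
      unfolding norm using p Cpos by (intro mult_strict_left_mono) auto
    with le show False by simp
  qed
  then show ?thesis using i unfolding s_def K_def by linarith
qed

end

text \<open>M = L + 1 is the least value with M > L. The bound 9 makes 1 / (L + 1) at most 0.1 and
  also suffices for p_D / n \<le> 0.6, so the discrepancy is at least 1 - 0.6 - 0.1.\<close>

lemma peak_discrepancy_hub_tree:
  assumes "9 \<le> L"
  shows "0.3 \<le> peak_discrepancy (hub_tree L (Suc L))"
proof -
  obtain l where L: "L = Suc l" using assms by (cases L) auto
  let ?T = "hub_tree L (Suc L)"
  have A: "peak_A ?T = 1" "num_terms_A ?T = Suc L"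
    unfolding L by (simp_all add: peak_A_hub_tree num_terms_A_hub_tree)
  have LL: "9 * L \<le> L * L" using assms by (rule mult_le_mono1)
  have D: "num_terms_D ?T = L * L + 2 * L + 2"
    by (simp add: num_terms_D_def hub_tree_def)
  have "2 * peak_D ?T \<le> 4 * L + L * L + 1"
    using peak_D_hub_tree[of l L] LL assms unfolding L by simp
  then have "10 * peak_D ?T \<le> 6 * num_terms_D ?T"
    using LL D by linarith
  then have "10 * real (peak_D ?T) \<le> 6 * real (num_terms_D ?T)" by linarith
  moreover have "0 < num_terms_D ?T" using D by simp
  ultimately have "real (peak_D ?T) / real (num_terms_D ?T) \<le> 0.6"
    by (simp add: divide_le_eq)
  moreover have "real (peak_A ?T) / real (num_terms_A ?T) \<le> 0.1"
    using assms by (simp add: A field_simps)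
  ultimately show ?thesis unfolding peak_discrepancy_def by linarith
qed

theorem mainTheorem1:
  shows "\<exists>T :: nat \<Rightarrow> nat pair_pre_digraph.
           (\<forall>k. labelled_tree (T k)) \<and>
           filterlim (\<lambda>k. num_terms_D (T k)) at_top sequentially \<and>
           filterlim (\<lambda>k. num_terms_A (T k)) at_top sequentially \<and>
           (\<forall>k. peak_discrepancy (T k) \<ge> 0.3)"
proof (intro exI[of _ "\<lambda>k. hub_tree (k + 9) (Suc (k + 9))"] conjI allI)
  fix k
  show "labelled_tree (hub_tree (k + 9) (Suc (k + 9)))"
    unfolding hub_tree_def
    by (intro parent_function.labelled_tree_parent_tree parent_function_hub_parent) simp
  show "peak_discrepancy (hub_tree (k + 9) (Suc (k + 9))) \<ge> 0.3"
    by (rule peak_discrepancy_hub_tree) simp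
next
  have "k \<le> num_terms_D (hub_tree (k + 9) (Suc (k + 9)))" for k
    by (simp add: num_terms_D_def hub_tree_def algebra_simps)
  then show "filterlim (\<lambda>k. num_terms_D (hub_tree (k + 9) (Suc (k + 9)))) at_top sequentially"
    by (intro filterlim_at_top_mono[OF filterlim_ident]) auto
  have "k \<le> num_terms_A (hub_tree (k + 9) (Suc (k + 9)))" for k
  proof -
    have "k + 9 = Suc (k + 8)" by simp
    then show ?thesis by (simp only: num_terms_A_hub_tree)
  qed
  then show "filterlim (\<lambda>k. num_terms_A (hub_tree (k + 9) (Suc (k + 9)))) at_top sequentially"
    by (intro filterlim_at_top_mono[OF filterlim_ident]) auto
qed

end
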